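(* Let $\mathcal{F}$ be the smallest family of finite posets that contains every $X$-free finite poset and that is closed under the two operations $(\mathcal{P},\mathcal{Q}) \mapsto \mathcal{P} < \mathcal{Q}$ and $(\mathcal{P},\mathcal{Q}) \mapsto \mathcal{P} \sqcup \mathcal{Q}$ (applied to posets on disjoint ground sets). Then for every poset $\mathcal{P} \in \mathcal{F}$, $$f_{\mathcal{O}(\mathcal{P})} \le f_{\mathcal{C}(\mathcal{P})},$$ that is, for every $i$ the number of $i$-dimensional faces of the order polytope $\mathcal{O}(\mathcal{P})$ is at most the number of $i$-dimensional faces of the chain polytope $\mathcal{C}(\mathcal{P})$.
   Context: All posets are finite. For a finite poset $\mathcal{P}$, the order polytope $\mathcal{O}(\mathcal{P}) \subseteq \mathbb{R}^{\mathcal{P}}$ is defined by $0 \le x_i \le 1$ for all $i \in \mathcal{P}$ and $x_i \le x_j$ for all $i \le j$ in $\mathcal{P}$. The chain polytope $\mathcal{C}(\mathcal{P}) \subseteq \mathbb{R}^{\mathcal{P}}$ is defined by $x_i \ge 0$ for all $i \in \mathcal{P}$ and $\sum_{i \in C} x_i \le 1$ for every chain $C$ of $\mathcal{P}$. For posets $A,B$ on disjoint sets, the ordinal sum $A<B$ is the poset on $A \cup B$ with $x \le y$ iff $x \le y$ in $A$, or $x\le y$ in $B$, or $x \in A$ and $y \in B$; the disjoint union $A \sqcup B$ is the poset on $A\cup B$ with $x \le y$ iff $x \le y$ in $A$ or $x \le y$ in $B$. The $X$-poset is the 5-element poset with elements $a,b,c,d,e$ whose cover relations are $a<c$, $b<c$,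 $c<d$, $c<e$ (two minimal elements below a middle element, which is below two maximal elements). A poset is $X$-free if it has no induced subposet isomorphic to the $X$-poset. For a polytope $P$ of dimension $d$, its $f$-polynomial is $f_P = \sum_{i=-1}^{d} f_i x^{i+1}$, where $f_i$ is the number of $i$-dimensional faces of $P$ (the empty face has dimension $-1$ and $P$ itself counts as a face). For polynomials $f,g$ with nonnegative integer coefficients, $f \le g$ means that every coefficient of $f$ is at most the corresponding coefficient of $g$. *)

theory Defs
  imports "HOL-Analysis.Analysis" "HOL-Computational_Algebra.Polynomial"
begin

text \<open>A finite poset is a finite ground set \<open>A\<close> together with its (reflexive) order relation
  \<open>r \<subseteq> A \<times> A\<close>, satisfying \<open>partial_order_on A r\<close>.\<close>

definition ordinal_sum :: "'a set \<Rightarrow> 'a rel \<Rightarrow> 'a set \<Rightarrow> 'a rel \<Rightarrow> 'a rel" where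
  "ordinal_sum A r B s = r \<union> s \<union> A \<times> B"

definition poset_isomorphic :: "'a set \<Rightarrow> 'a rel \<Rightarrow> 'b set \<Rightarrow> 'b rel \<Rightarrow> bool" where
  "poset_isomorphic A r B s \<longleftrightarrow>
     (\<exists>h. bij_betw h A B \<and> (\<forall>x\<in>A. \<forall>y\<in>A. (x, y) \<in> r \<longleftrightarrow> (h x, h y) \<in> s))"

datatype X_elem = Xa | Xb | Xc | Xd | Xe

definition X_order :: "X_elem rel" where
  "X_order = {(Xa, Xc), (Xb, Xc), (Xc, Xd), (Xc, Xe)}\<^sup>*"

definition X_free :: "'a set \<Rightarrow> 'a rel \<Rightarrow> bool" where
  "X_free A r \<longleftrightarrow>
     \<not> (\<exists>S\<subseteq>A. poset_isomorphic S (r \<inter> S \<times> S) (UNIV :: X_elem set) X_order)"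

text \<open>The ground sets of the two arguments of either operation are subsets of the ground set of
  the result, so the family may be generated inside the type of the final ground set.\<close>

inductive X_family :: "'a set \<Rightarrow> 'a rel \<Rightarrow> bool" where
  X_free: "finite A \<Longrightarrow> partial_order_on A r \<Longrightarrow> X_free A r \<Longrightarrow> X_family A r"
| ordinal_sum: "X_family A r \<Longrightarrow> X_family B s \<Longrightarrow> A \<inter> B = {} \<Longrightarrow>
    X_family (A \<union> B) (ordinal_sum A r B s)"
| disjoint_union: "X_family A r \<Longrightarrow> X_family B s \<Longrightarrow> A \<inter> B = {} \<Longrightarrow>
    X_family (A \<union> B) (r \<union> s)"

text \<open>For \<open>A\<close> a set of elements of a finite type \<open>'a\<close>, the space of real vectors indexed by \<open>A\<close> is
  realised as the coordinate subspace of \<open>real ^ 'a\<close> on which the coordinates outside \<open>A\<close> vanish.\<close>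

definition order_polytope :: "'a::finite set \<Rightarrow> 'a rel \<Rightarrow> (real ^ 'a) set" where
  "order_polytope A r =
     {x. (\<forall>i. i \<notin> A \<longrightarrow> x $ i = 0) \<and>
         (\<forall>i\<in>A. 0 \<le> x $ i \<and> x $ i \<le> 1) \<and>
         (\<forall>i j. (i, j) \<in> r \<longrightarrow> x $ i \<le> x $ j)}"

definition chain_polytope :: "'a::finite set \<Rightarrow> 'a rel \<Rightarrow> (real ^ 'a) set" where
  "chain_polytope A r =
     {x. (\<forall>i. i \<notin> A \<longrightarrow> x $ i = 0) \<and>
         (\<forall>i\<in>A. 0 \<le> x $ i) \<and>
         (\<forall>C\<in>Chains r. (\<Sum>i\<in>C. x $ i) \<le> 1)}"

definition face_number :: "'v::euclidean_space set \<Rightarrow> int \<Rightarrow> nat" where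
  "face_number P i = card {F. F face_of P \<and> aff_dim F = i}"

definition f_polynomial :: "'v::euclidean_space set \<Rightarrow> nat poly" where
  "f_polynomial P = (\<Sum>i = -1..aff_dim P. monom (face_number P i) (nat (i + 1)))"

definition coeffwise_le :: "nat poly \<Rightarrow> nat poly \<Rightarrow> bool" where
  "coeffwise_le f g \<longleftrightarrow> (\<forall>k. coeff f k \<le> coeff g k)"

lemma coeff_f_polynomial: "coeff (f_polynomial P) k = face_number P (int k - 1)"
proof -
  have "coeff (f_polynomial P) k =
      (\<Sum>i = -1..aff_dim P. if i = int k - 1 then face_number P i else 0)"
    unfolding f_polynomial_def coeff_sum by (intro sum.cong refl) auto
  also have "\<dots> = (if int k - 1 \<le> aff_dim P then face_number P (int k - 1) else 0)"
    by (simp add: sum.delta)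
  also have "\<dots> = face_number P (int k - 1)"
  proof (cases "int k - 1 \<le> aff_dim P")
    case False
    have "aff_dim F \<noteq> int k - 1" if "F face_of P" for F
      using False aff_dim_subset[OF face_of_imp_subset[OF that]] by linarith
    then have "{F. F face_of P \<and> aff_dim F = int k - 1} = {}" by blast
    then have "face_number P (int k - 1) = 0" unfolding face_number_def by (metis card.empty)
    then show ?thesis using False by simp
  qed simp
  finally show ?thesis .
qed

lemma partial_order_on_ordinal_sum:
  assumes "partial_order_on A r" "partial_order_on B s" "A \<inter> B = {}"
  shows "partial_order_on (A \<union> B) (ordinal_sum A r B s)"
proof -
  have r: "r \<subseteq> A \<times> A" "refl_on A r" "trans r" "antisym r"
    and s: "s \<subseteq> B \<times> B" "refl_on B s" "trans s" "antisym s"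
    using assms unfolding partial_order_on_def preorder_on_def by auto
  have "ordinal_sum A r B s \<subseteq> (A \<union> B) \<times> (A \<union> B)"
    using r(1) s(1) unfolding ordinal_sum_def by blast
  moreover have "refl_on (A \<union> B) (ordinal_sum A r B s)"
    using r(2) s(2) unfolding ordinal_sum_def refl_on_def by blast
  moreover have "trans (ordinal_sum A r B s)"
  proof (rule transI)
    fix x y z assume "(x, y) \<in> ordinal_sum A r B s" "(y, z) \<in> ordinal_sum A r B s"
    then show "(x, z) \<in> ordinal_sum A r B s"
      using r(1) s(1) assms(3) transD[OF r(3), of x y z] transD[OF s(3), of x y z]
      unfolding ordinal_sum_def by blast
  qed
  moreover have "antisym (ordinal_sum A r B s)"
  proof (rule antisymI)
    fix x y assume "(x, y) \<in> ordinal_sum A r B s" "(y, x) \<in> ordinal_sum A r B s"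
    then show "x = y"
      using r(1) s(1) assms(3) antisymD[OF r(4), of x y] antisymD[OF s(4), of x y]
      unfolding ordinal_sum_def by blast
  qed
  ultimately show ?thesis unfolding partial_order_on_def preorder_on_def by blast
qed

lemma partial_order_on_disjoint_union:
  assumes "partial_order_on A r" "partial_order_on B s" "A \<inter> B = {}"
  shows "partial_order_on (A \<union> B) (r \<union> s)"
proof -
  have r: "r \<subseteq> A \<times> A" "refl_on A r" "trans r" "antisym r"
    and s: "s \<subseteq> B \<times> B" "refl_on B s" "trans s" "antisym s"
    using assms unfolding partial_order_on_def preorder_on_def by auto
  have "r \<union> s \<subseteq> (A \<union> B) \<times> (A \<union> B)"
    using r(1) s(1) by blast
  moreover have "refl_on (A \<union> B) (r \<union> s)"
    using r(2) s(2) unfolding refl_on_def by blast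
  moreover have "trans (r \<union> s)"
  proof (rule transI)
    fix x y z assume "(x, y) \<in> r \<union> s" "(y, z) \<in> r \<union> s"
    then show "(x, z) \<in> r \<union> s"
      using r(1) s(1) assms(3) transD[OF r(3), of x y z] transD[OF s(3), of x y z] by blast
  qed
  moreover have "antisym (r \<union> s)"
  proof (rule antisymI)
    fix x y assume "(x, y) \<in> r \<union> s" "(y, x) \<in> r \<union> s"
    then show "x = y"
      using r(1) s(1) assms(3) antisymD[OF r(4), of x y] antisymD[OF s(4), of x y] by blast
  qed
  ultimately show ?thesis unfolding partial_order_on_def preorder_on_def by blast
qed

lemma X_family_poset: "X_family A r \<Longrightarrow> finite A \<and> partial_order_on A r"
  by (induction rule: X_family.induct)
    (simp_all add: partial_order_on_ordinal_sum partial_order_on_disjoint_union)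

lemma polytope_if_bounded_coordinates:
  fixes P :: "(real ^ 'a::finite) set"
  assumes "polyhedron P" and "\<And>x i. x \<in> P \<Longrightarrow> 0 \<le> x $ i \<and> x $ i \<le> 1"
  shows "polytope P"
proof -
  have "P \<subseteq> cbox 0 (\<chi> i. 1)"
    using assms(2) by (auto simp: mem_box_cart)
  then show ?thesis
    using assms(1) bounded_cbox bounded_subset polytope_eq_bounded_polyhedron by blast
qed

lemma polytope_order_polytope: "polytope (order_polytope A r)"
proof (rule polytope_if_bounded_coordinates)
  have eq: "order_polytope A r =
      \<Inter> ((\<lambda>i. {x. axis i 1 \<bullet> x = 0}) ` (- A)
       \<union> (\<lambda>i. {x. axis i 1 \<bullet> x \<ge> 0}) ` A \<union> (\<lambda>i. {x. axis i 1 \<bullet> x \<le> 1}) ` A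
       \<union> (\<lambda>(i, j). {x. (axis i 1 - axis j 1) \<bullet> x \<le> 0}) ` r)"
    unfolding order_polytope_def
    by (auto simp: inner_axis' inner_diff_left)
  show "polyhedron (order_polytope A r)" unfolding eq
    by (intro polyhedron_Inter)
      (auto intro: polyhedron_halfspace_le polyhedron_halfspace_ge polyhedron_hyperplane)
  show "\<And>x i. x \<in> order_polytope A r \<Longrightarrow> 0 \<le> x $ i \<and> x $ i \<le> 1"
    unfolding order_polytope_def using zero_le_one order_refl by (smt (verit) mem_Collect_eq)
qed

lemma polytope_chain_polytope:
  assumes "partial_order_on A r"
  shows "polytope (chain_polytope A r)"
proof (rule polytope_if_bounded_coordinates)
  have eq: "chain_polytope A r =
      \<Inter> ((\<lambda>i. {x. axis i 1 \<bullet> x = 0}) ` (- A) \<union> (\<lambda>i. {x. axis i 1 \<bullet> x \<ge> 0}) ` A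
       \<union> (\<lambda>C. {x. (\<Sum>i\<in>C. axis i 1) \<bullet> x \<le> 1}) ` Chains r)"
    unfolding chain_polytope_def
    by (auto simp: inner_axis' inner_sum_left)
  show "polyhedron (chain_polytope A r)" unfolding eq
    by (intro polyhedron_Inter)
      (auto intro: polyhedron_halfspace_le polyhedron_halfspace_ge polyhedron_hyperplane)
  fix x i assume x: "x \<in> chain_polytope A r"
  show "0 \<le> x $ i \<and> x $ i \<le> 1"
  proof (cases "i \<in> A")
    case True
    then have "{i} \<in> Chains r"
      using assms by (auto simp: Chains_def partial_order_on_def preorder_on_def refl_on_def)
    then have "(\<Sum>j\<in>{i}. x $ j) \<le> 1" using x unfolding chain_polytope_def by blast
    then show ?thesis using x True unfolding chain_polytope_def by auto
  qed (use x in \<open>auto simp: chain_polytope_def\<close>)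
qed

end

theory Submission
  imports Defs
begin

text \<open>
  An X-free poset splits into a down-set in which every principal ideal is a chain and an up-set in
  which every principal filter is a chain. Summing along these chains is an affine isomorphism from
  the chain polytope onto the order polytope. Disjoint unions of posets give products of polytopes.

  For ordinal sums, grade the faces of a polytope containing the origin by their linear dimension,
  and let \<open>a\<close> and \<open>b\<close> be the generating polynomials of the faces through and off the origin, so
  that the \<open>f\<close>-polynomial is \<open>x a + b\<close>. Both polytopes of an ordinal sum are, up to affine
  isomorphism, the convex hull of the union of the two given polytopes placed in complementary
  subspaces (for order polytopes the upper one reversed), and there both \<open>a\<close> and \<open>b\<close> are
  multiplicative. Choosing for each face through the origin a facet off the origin shows \<open>a \<le> b\<close>.
  The origin is a simple vertex of the chain polytope, so \<open>a\<close> is as small as the dimension permits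
  there. With \<open>\<alpha>\<close>, \<open>\<beta>\<close> denoting \<open>a\<close>, \<open>b\<close> for the chain polytopes, the inequality follows from
  \<open>(x \<alpha> \<alpha>' + \<beta> \<beta>') - (x a a' + b b') = x (a - \<alpha>) (b' - a') + (x \<alpha> + \<beta> - x a - b) b'
    + x (a' - \<alpha>') (\<beta> - \<alpha>) + \<beta> (x \<alpha>' + \<beta>' - x a' - b')\<close>,
  where every factor on the right has nonnegative coefficients.
\<close>

section \<open>Rank generating functions\<close>

definition rank_polynomial :: "('a \<Rightarrow> nat) \<Rightarrow> 'a set \<Rightarrow> nat poly" where
  "rank_polynomial \<rho> X = (\<Sum>x\<in>X. monom 1 (\<rho> x))"

lemma coeff_rank_polynomial:
  assumes "finite X"
  shows "coeff (rank_polynomial \<rho> X) k = card {x \<in> X. \<rho> x = k}"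
proof -
  have "coeff (rank_polynomial \<rho> X) k = (\<Sum>x\<in>X. if \<rho> x = k then 1 else 0)"
    by (simp add: rank_polynomial_def coeff_sum del: One_nat_def)
  also have "\<dots> = card {x \<in> X. \<rho> x = k}"
    using assms by (simp add: sum.inter_filter[symmetric])
  finally show ?thesis .
qed

lemma rank_polynomial_bij_betw:
  assumes "bij_betw f X Y" "\<And>x. x \<in> X \<Longrightarrow> \<sigma> (f x) = \<rho> x"
  shows "rank_polynomial \<rho> X = rank_polynomial \<sigma> Y"
  using sum.reindex_bij_betw[OF assms(1), of "\<lambda>y. monom 1 (\<sigma> y)"] assms(2)
  by (simp add: rank_polynomial_def del: One_nat_def)

lemma rank_polynomial_cong:
  "(\<And>x. x \<in> X \<Longrightarrow> \<rho> x = \<sigma> x) \<Longrightarrow> rank_polynomial \<rho> X = rank_polynomial \<sigma> X"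
  by (simp add: rank_polynomial_def)

lemma rank_polynomial_Times:
  "rank_polynomial (\<lambda>(x, y). \<rho> x + \<sigma> y) (X \<times> Y) = rank_polynomial \<rho> X * rank_polynomial \<sigma> Y"
  by (simp add: rank_polynomial_def sum_product sum.cartesian_product mult_monom case_prod_unfold)

lemma rank_polynomial_Un_disjoint:
  assumes "finite X" "finite Y" "X \<inter> Y = {}"
  shows "rank_polynomial \<rho> (X \<union> Y) = rank_polynomial \<rho> X + rank_polynomial \<rho> Y"
  using assms by (simp add: rank_polynomial_def sum.union_disjoint)

lemma rank_polynomial_Suc:
  "rank_polynomial (\<lambda>x. Suc (\<rho> x)) X = [:0, 1:] * rank_polynomial \<rho> X"
  by (simp add: rank_polynomial_def sum_distrib_left monom_Suc del: One_nat_def)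

lemma rank_polynomial_card_Pow:
  assumes "finite A"
  shows "rank_polynomial card (Pow A) = [:1, 1:] ^ card A"
  using assms
proof (induction rule: finite_induct)
  case empty
  then show ?case by (simp add: rank_polynomial_def del: One_nat_def)
next
  case (insert a A)
  have "rank_polynomial card (Pow (insert a A)) =
      rank_polynomial card (Pow A) + rank_polynomial card (insert a ` Pow A)"
    unfolding Pow_insert using insert.hyps by (intro rank_polynomial_Un_disjoint) auto
  also have "rank_polynomial card (insert a ` Pow A) = rank_polynomial (\<lambda>B. Suc (card B)) (Pow A)"
  proof (rule rank_polynomial_bij_betw[symmetric])
    show "bij_betw (insert a) (Pow A) (insert a ` Pow A)"
      using insert.hyps(2) by (auto simp: bij_betw_def inj_on_def)
    show "card (insert a B) = Suc (card B)" if "B \<in> Pow A" for B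
      using that insert.hyps finite_subset by (metis PowD card_insert_disjoint in_mono)
  qed
  finally show ?case
    using insert by (simp add: rank_polynomial_Suc del: One_nat_def)
qed

lemma coeffwise_le_iff_add: "coeffwise_le f g \<longleftrightarrow> (\<exists>h. g = f + h)"
proof
  assume "coeffwise_le f g"
  then have "g = f + (g - f)" by (simp add: poly_eq_iff coeffwise_le_def)
  then show "\<exists>h. g = f + h" by blast
qed (auto simp: coeffwise_le_def)

lemma coeffwise_le_trans [trans]: "coeffwise_le f g \<Longrightarrow> coeffwise_le g h \<Longrightarrow> coeffwise_le f h"
  using order_trans by (fastforce simp: coeffwise_le_def)

lemma coeffwise_le_add: "coeffwise_le f f' \<Longrightarrow> coeffwise_le g g' \<Longrightarrow> coeffwise_le (f + g) (f' + g')"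
  by (simp add: coeffwise_le_def add_mono)

lemma coeffwise_le_mult: "coeffwise_le f f' \<Longrightarrow> coeffwise_le g g' \<Longrightarrow> coeffwise_le (f * g) (f' * g')"
  by (simp add: coeffwise_le_def coeff_mult sum_mono mult_mono)

lemma coeffwise_le_refl: "coeffwise_le f f"
  by (simp add: coeffwise_le_def)

lemma coeffwise_le_rank_polynomial_inj:
  assumes "finite Y" "inj_on f X" "f ` X \<subseteq> Y" "\<And>x. x \<in> X \<Longrightarrow> \<sigma> (f x) = \<rho> x"
  shows "coeffwise_le (rank_polynomial \<rho> X) (rank_polynomial \<sigma> Y)"
proof -
  have "rank_polynomial \<rho> X = rank_polynomial \<sigma> (f ` X)"
    using assms(2,4) by (intro rank_polynomial_bij_betw) (auto simp: bij_betw_def)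
  moreover have "rank_polynomial \<sigma> Y = rank_polynomial \<sigma> (f ` X) + rank_polynomial \<sigma> (Y - f ` X)"
    using assms(1,3) rank_polynomial_Un_disjoint[of "f ` X" "Y - f ` X" \<sigma>]
    by (simp add: finite_subset Un_absorb1)
  ultimately show ?thesis by (auto simp: coeffwise_le_iff_add)
qed

lemma finite_faces_Collect:
  fixes P :: "'v::euclidean_space set"
  assumes "polytope P"
  shows "finite {F. F face_of P \<and> Q F}"
  using finite_polytope_faces[OF assms] by (rule rev_finite_subset) auto

lemma f_polynomial_eq_rank_polynomial:
  assumes "polytope P"
  shows "f_polynomial P = rank_polynomial (\<lambda>F. nat (aff_dim F + 1)) {F. F face_of P}"
proof (rule poly_eqI)
  fix k
  have "aff_dim F = int k - 1 \<longleftrightarrow> nat (aff_dim F + 1) = k" for F :: "'a set"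
    using aff_dim_geq[of F] by linarith
  then show "coeff (f_polynomial P) k =
      coeff (rank_polynomial (\<lambda>F. nat (aff_dim F + 1)) {F. F face_of P}) k"
    by (simp add: coeff_f_polynomial face_number_def coeff_rank_polynomial
        finite_polytope_faces[OF assms])
qed

section \<open>Affine isomorphisms\<close>

definition affine_map :: "('a::real_vector \<Rightarrow> 'b::real_vector) \<Rightarrow> bool" where
  "affine_map f \<longleftrightarrow> linear (\<lambda>x. f x - f 0)"

lemma affine_map_segment:
  assumes "affine_map f"
  shows "f ((1 - u) *\<^sub>R x + u *\<^sub>R y) = (1 - u) *\<^sub>R f x + u *\<^sub>R f y"
proof -
  have "f ((1 - u) *\<^sub>R x + u *\<^sub>R y) - f 0 = (1 - u) *\<^sub>R (f x - f 0) + u *\<^sub>R (f y - f 0)"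
    using assms linear_add linear_scale unfolding affine_map_def by fastforce
  then show ?thesis by (simp add: algebra_simps)
qed

lemma convex_affine_image:
  assumes "affine_map f" "convex S"
  shows "convex (f ` S)"
  unfolding convex_alt
  using assms(2) by (auto simp: affine_map_segment[OF assms(1), symmetric] convexD_alt)

lemma aff_dim_affine_image_le:
  fixes f :: "'a::euclidean_space \<Rightarrow> 'b::euclidean_space"
  assumes "affine_map f"
  shows "aff_dim (f ` S) \<le> aff_dim S"
proof -
  have "f ` S = (+) (f 0) ` (\<lambda>x. f x - f 0) ` S" by (auto simp: image_image)
  then show ?thesis
    using aff_dim_linear_image_le[of "\<lambda>x. f x - f 0" S] assms
    by (simp add: affine_map_def aff_dim_translation_eq)
qed

lemma face_of_affine_image:
  assumes f: "affine_map f" and g: "affine_map g" and gf: "\<And>x. x \<in> S \<Longrightarrow> g (f x) = x"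
    and F: "F face_of S"
  shows "f ` F face_of f ` S"
  unfolding face_of_def
proof (intro conjI ballI impI)
  have sub: "F \<subseteq> S" using F by (rule face_of_imp_subset)
  then show "f ` F \<subseteq> f ` S" by (rule image_mono)
  show "convex (f ` F)" using f face_of_imp_convex[OF F] by (rule convex_affine_image)
  fix a' b' z assume "a' \<in> f ` S" "b' \<in> f ` S" "z \<in> f ` F" and seg: "z \<in> open_segment a' b'"
  then obtain a b x where ab: "a' = f a" "b' = f b" "z = f x" "a \<in> S" "b \<in> S" "x \<in> F" by blast
  obtain u where u: "0 < u" "u < 1" "f x = (1 - u) *\<^sub>R f a + u *\<^sub>R f b" "a \<noteq> b"
    using seg ab by (auto simp: in_segment)
  have "x = (1 - u) *\<^sub>R a + u *\<^sub>R b"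
    using affine_map_segment[OF g, of u "f a" "f b"] u(3) gf ab sub by (metis subsetD)
  then have "x \<in> open_segment a b" using u by (auto simp: in_segment)
  then have "a \<in> F \<and> b \<in> F" using face_ofD[OF F] ab by blast
  then show "a' \<in> f ` F" "b' \<in> f ` F" using ab by auto
qed

lemma affine_isomorphism_face:
  fixes f :: "'a::euclidean_space \<Rightarrow> 'b::euclidean_space"
  assumes f: "affine_map f" and g: "affine_map g" and gf: "\<And>x. x \<in> S \<Longrightarrow> g (f x) = x"
    and F: "F face_of S"
  shows "f ` F face_of f ` S" and "aff_dim (f ` F) = aff_dim F" and "g ` f ` F = F"
proof -
  show "f ` F face_of f ` S" by (rule face_of_affine_image[OF assms])
  show inverse: "g ` f ` F = F"
    using gf face_of_imp_subset[OF F] by (force simp: image_image)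
  show "aff_dim (f ` F) = aff_dim F"
    using aff_dim_affine_image_le[OF f, of F] aff_dim_affine_image_le[OF g, of "f ` F"]
    by (simp add: inverse)
qed

definition affinely_isomorphic :: "'a::real_vector set \<Rightarrow> 'b::real_vector set \<Rightarrow> bool" where
  "affinely_isomorphic S T \<longleftrightarrow> (\<exists>f g. affine_map f \<and> affine_map g \<and> f ` S = T \<and> g ` T = S \<and>
     (\<forall>x\<in>S. g (f x) = x) \<and> (\<forall>y\<in>T. f (g y) = y))"

lemma affinely_isomorphicI:
  assumes "affine_map f" "affine_map g"
    and "\<And>x. x \<in> S \<Longrightarrow> f x \<in> T" "\<And>y. y \<in> T \<Longrightarrow> g y \<in> S"
    and "\<And>x. x \<in> S \<Longrightarrow> g (f x) = x" "\<And>y. y \<in> T \<Longrightarrow> f (g y) = y"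
  shows "affinely_isomorphic S T"
  unfolding affinely_isomorphic_def
proof (intro exI conjI)
  show "f ` S = T" "g ` T = S"
    using assms(3-6) by (metis image_subsetI subsetI image_eqI subset_antisym)+
qed (use assms in auto)

lemma f_polynomial_affinely_isomorphic:
  fixes S :: "'a::euclidean_space set" and T :: "'b::euclidean_space set"
  assumes "affinely_isomorphic S T"
  shows "f_polynomial S = f_polynomial T"
proof -
  obtain f g where f: "affine_map f" "f ` S = T" "\<And>x. x \<in> S \<Longrightarrow> g (f x) = x"
    and g: "affine_map g" "g ` T = S" "\<And>y. y \<in> T \<Longrightarrow> f (g y) = y"
    using assms unfolding affinely_isomorphic_def by metis
  note face_f = affine_isomorphism_face[where S = S, OF f(1) g(1) f(3), unfolded f(2)]
  note face_g = affine_isomorphism_face[where S = T, OF g(1) f(1) g(3), unfolded g(2)]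
  have "bij_betw ((`) f) {F. F face_of S \<and> aff_dim F = i} {G. G face_of T \<and> aff_dim G = i}" for i
    by (rule bij_betwI[where g = "(`) g"]) (use face_f face_g in auto)
  then have "face_number S i = face_number T i" for i
    unfolding face_number_def by (rule bij_betw_same_card)
  then show ?thesis by (simp add: poly_eq_iff coeff_f_polynomial)
qed

lemma affinely_isomorphic_vimage:
  fixes f :: "'a::euclidean_space \<Rightarrow> 'a"
  assumes "affine_map f" "inj f"
  shows "affinely_isomorphic (f -` T) T"
proof -
  have "linear (\<lambda>x. f x - f 0)" "inj (\<lambda>x. f x - f 0)"
    using assms by (auto simp: affine_map_def inj_def)
  then obtain h where h: "linear h" "\<And>x. h (f x - f 0) = x" "\<And>x. f (h x) - f 0 = x"
    using linear_injective_isomorphism[of "\<lambda>x. f x - f 0"] by auto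
  show ?thesis
  proof (rule affinely_isomorphicI[where f = f])
    show "affine_map (\<lambda>y. h (y - f 0))"
      using h(1) by (simp add: affine_map_def linear_diff linear_0)
    show "f (h (y - f 0)) = y" for y using h(3)[of "y - f 0"] by simp
    then show "h (y - f 0) \<in> f -` T" if "y \<in> T" for y using that by simp
  qed (use assms h(2) in auto)
qed

section \<open>Products\<close>

lemma span_union_axes:
  fixes F :: "'a::real_vector set" and G :: "'b::real_vector set"
  shows "span (F \<times> {0} \<union> {0} \<times> G) = span F \<times> span G" (is "span ?U = _")
proof
  show "span ?U \<subseteq> span F \<times> span G"
    by (intro span_minimal subspace_Times subspace_span) (auto intro: span_base span_0)
  have "(\<lambda>x. (x, 0)) ` span F = span ((\<lambda>x. (x, 0)) ` F)"
    by (rule linear_span_image[symmetric]) (auto intro: linearI)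
  also have "\<dots> \<subseteq> span ?U" by (intro span_mono) auto
  finally have left: "(x, 0) \<in> span ?U" if "x \<in> span F" for x using that by blast
  have "(\<lambda>y. (0, y)) ` span G = span ((\<lambda>y. (0, y)) ` G)"
    by (rule linear_span_image[symmetric]) (auto intro: linearI)
  also have "\<dots> \<subseteq> span ?U" by (intro span_mono) auto
  finally have right: "(0, y) \<in> span ?U" if "y \<in> span G" for y using that by blast
  show "span F \<times> span G \<subseteq> span ?U"
    using span_add[OF left right] by auto
qed

lemma dim_between_axes_and_span_Times:
  fixes F :: "'a::euclidean_space set" and G :: "'b::euclidean_space set"
  assumes "F \<times> {0} \<union> {0} \<times> G \<subseteq> U" "U \<subseteq> span F \<times> span G"
  shows "dim U = dim F + dim G"
proof -
  have "span U = span F \<times> span G"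
    using span_mono[OF assms(1)] span_minimal[OF assms(2)]
    by (auto simp: span_union_axes subspace_Times)
  then have "dim U = dim (span F \<times> span G)" by (metis dim_span)
  then show ?thesis by (simp add: dim_Times)
qed

lemma aff_dim_Times:
  fixes F :: "'a::euclidean_space set" and G :: "'b::euclidean_space set"
  assumes "F \<noteq> {}" "G \<noteq> {}"
  shows "aff_dim (F \<times> G) = aff_dim F + aff_dim G"
proof -
  obtain a b where ab: "a \<in> F" "b \<in> G" using assms by blast
  define F' G' where "F' = (+) (- a) ` F" and "G' = (+) (- b) ` G"
  have zero: "0 \<in> F'" "0 \<in> G'" using ab by (force simp: F'_def G'_def)+
  have "dim (F' \<times> G') = dim F' + dim G'"
    by (rule dim_between_axes_and_span_Times) (use zero in \<open>auto intro: span_base\<close>)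
  then have "aff_dim (F' \<times> G') = aff_dim F' + aff_dim G'"
    using zero by (simp add: aff_dim_zero hull_inc zero_prod_def)
  moreover have "F' \<times> G' = (+) (- (a, b)) ` (F \<times> G)"
    by (force simp: F'_def G'_def)
  ultimately show ?thesis by (simp only: F'_def G'_def aff_dim_translation_eq)
qed

definition nonempty_face_polynomial :: "'v::euclidean_space set \<Rightarrow> nat poly" where
  "nonempty_face_polynomial P = rank_polynomial (\<lambda>F. nat (aff_dim F)) {F. F face_of P \<and> F \<noteq> {}}"

lemma f_polynomial_eq_nonempty_face_polynomial:
  assumes "polytope P"
  shows "f_polynomial P = 1 + [:0, 1:] * nonempty_face_polynomial P"
proof -
  let ?N = "{F. F face_of P \<and> F \<noteq> {}}"
  have "rank_polynomial (\<lambda>F. nat (aff_dim F + 1)) ?N =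
      rank_polynomial (\<lambda>F. Suc (nat (aff_dim F))) ?N"
    by (rule rank_polynomial_cong)
      (auto simp: Suc_nat_eq_nat_zadd1 add.commute not_less[symmetric])
  moreover have "{F. F face_of P} = {{}} \<union> ?N" by auto
  ultimately show ?thesis
    using rank_polynomial_Un_disjoint[of "{{}}" ?N "\<lambda>F. nat (aff_dim F + 1)"]
      finite_faces_Collect[OF assms]
    by (simp add: f_polynomial_eq_rank_polynomial[OF assms] nonempty_face_polynomial_def
        rank_polynomial_Suc) (simp add: rank_polynomial_def del: One_nat_def)
qed

lemma nonempty_face_polynomial_Times:
  fixes P :: "'a::euclidean_space set" and Q :: "'b::euclidean_space set"
  shows "nonempty_face_polynomial (P \<times> Q) = nonempty_face_polynomial P * nonempty_face_polynomial Q"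
proof -
  let ?X = "{F. F face_of P \<and> F \<noteq> {}}" and ?Y = "{G. G face_of Q \<and> G \<noteq> {}}"
  have "bij_betw (\<lambda>(F, G). F \<times> G) (?X \<times> ?Y) {H. H face_of P \<times> Q \<and> H \<noteq> {}}"
    by (auto simp: bij_betw_def inj_on_def times_eq_iff face_of_Times_decomp image_iff)
  moreover have "nat (aff_dim (F \<times> G)) = nat (aff_dim F) + nat (aff_dim G)"
    if "F \<noteq> {}" "G \<noteq> {}" for F :: "'a set" and G :: "'b set"
    using that by (simp add: aff_dim_Times nat_add_distrib not_less[symmetric])
  ultimately have "rank_polynomial (\<lambda>(F, G). nat (aff_dim F) + nat (aff_dim G)) (?X \<times> ?Y)
      = nonempty_face_polynomial (P \<times> Q)"
    unfolding nonempty_face_polynomial_def by (intro rank_polynomial_bij_betw) auto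
  then show ?thesis by (simp add: rank_polynomial_Times nonempty_face_polynomial_def)
qed

lemma coeffwise_le_f_polynomial_iff:
  assumes "polytope P" "polytope Q"
  shows "coeffwise_le (f_polynomial P) (f_polynomial Q) \<longleftrightarrow>
    coeffwise_le (nonempty_face_polynomial P) (nonempty_face_polynomial Q)"
  using assms
  by (auto simp: f_polynomial_eq_nonempty_face_polynomial coeffwise_le_def coeff_pCons
      split: nat.splits)

lemma coeffwise_le_f_polynomial_Times:
  fixes P P' :: "'a::euclidean_space set" and Q Q' :: "'b::euclidean_space set"
  assumes "polytope P" "polytope P'" "polytope Q" "polytope Q'"
    and "coeffwise_le (f_polynomial P) (f_polynomial P')"
    and "coeffwise_le (f_polynomial Q) (f_polynomial Q')"
  shows "coeffwise_le (f_polynomial (P \<times> Q)) (f_polynomial (P' \<times> Q'))"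
  using assms
  by (simp add: coeffwise_le_f_polynomial_iff polytope_Times nonempty_face_polynomial_Times
      coeffwise_le_mult)

section \<open>Faces containing a point and faces avoiding it\<close>

text \<open>Coatoms of the face lattice rather than facets: below a vertex, the coatom is the empty face,
  which \<open>facet_of\<close> excludes.\<close>

lemma exists_coatom_face_avoiding:
  fixes P :: "'v::euclidean_space set"
  assumes P: "polytope P" and E: "E face_of P" and x: "x \<in> P" "x \<notin> E"
  shows "\<exists>G. G face_of P \<and> E \<subseteq> G \<and> x \<notin> G \<and> aff_dim G = aff_dim P - 1"
proof -
  have facet: "\<exists>G. G face_of P \<and> E' \<subseteq> G \<and> x \<notin> G \<and> aff_dim G = aff_dim P - 1"
    if E': "E' face_of P" "E' \<noteq> {}" "x \<notin> E'" for E'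
  proof -
    have "E' = \<Inter> {G. G facet_of P \<and> E' \<subseteq> G}"
      using face_of_polyhedron[OF polytope_imp_polyhedron[OF P]] E' x(1) by blast
    then obtain G where "G facet_of P" "E' \<subseteq> G" "x \<notin> G" using E'(3) by blast
    then show ?thesis by (auto simp: facet_of_def)
  qed
  consider (nonempty) "E \<noteq> {}" | (singleton) "E = {}" "P = {x}" | (empty) "E = {}" "P \<noteq> {x}"
    by blast
  then show ?thesis
  proof cases
    case nonempty
    then show ?thesis using facet E x(2) by blast
  next
    case singleton
    then show ?thesis by (intro exI[of _ "{}"]) auto
  next
    case empty
    have "P = convex hull {v. v extreme_point_of P}"
      using P by (intro Krein_Milman_Minkowski polytope_imp_compact polytope_imp_convex)
    then have "\<not> {v. v extreme_point_of P} \<subseteq> {x}"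
      using empty(2) x(1)
      by (metis convex_hull_empty convex_hull_singleton empty_iff subset_singletonD)
    then obtain v where "v extreme_point_of P" "v \<noteq> x" by blast
    then show ?thesis using facet[of "{v}"] empty(1) by (auto simp: face_of_singleton)
  qed
qed

lemma face_subset_if_common_coatom:
  fixes P :: "'v::euclidean_space set"
  assumes F: "F face_of P" "F' face_of P" and x: "x \<in> F" "x \<in> F'" "x \<notin> G"
    and G: "G face_of F" "G \<subseteq> F'" "aff_dim G = aff_dim F - 1"
  shows "F \<subseteq> F'"
proof (rule ccontr)
  assume "\<not> F \<subseteq> F'"
  have "F \<inter> F' face_of F"
    using face_of_subset[OF face_of_Int[OF F] _ face_of_imp_subset[OF F(1)]] by simp
  then have "aff_dim (F \<inter> F') < aff_dim F"
    using \<open>\<not> F \<subseteq> F'\<close> face_of_imp_convex[OF F(1)] by (intro face_of_aff_dim_lt) auto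
  moreover have "aff_dim G < aff_dim (F \<inter> F')"
  proof (rule face_of_aff_dim_lt)
    show "convex (F \<inter> F')" using face_of_Int[OF F] by (rule face_of_imp_convex)
    show "G face_of F \<inter> F'"
      using G face_of_subset[OF G(1), of "F \<inter> F'"] face_of_imp_subset[OF G(1)] by simp
    show "G \<noteq> F \<inter> F'" using x by blast
  qed
  ultimately show False using G(3) by simp
qed

text \<open>A face through \<open>x\<close> is recovered from the coatom chosen for it as the smallest face containing
  that coatom and \<open>x\<close>.\<close>

lemma exists_coatom_injection:
  fixes P :: "'v::euclidean_space set"
  assumes P: "polytope P" and E: "E face_of P" and x: "x \<notin> E"
  shows "\<exists>g. inj_on g {F. F face_of P \<and> E \<subseteq> F \<and> x \<in> F} \<and>
    (\<forall>F. F face_of P \<and> E \<subseteq> F \<and> x \<in> F \<longrightarrow>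
      g F face_of P \<and> E \<subseteq> g F \<and> x \<notin> g F \<and> aff_dim (g F) = aff_dim F - 1)"
proof -
  have "\<exists>G. G face_of F \<and> E \<subseteq> G \<and> x \<notin> G \<and> aff_dim G = aff_dim F - 1"
    if "F face_of P" "E \<subseteq> F" "x \<in> F" for F
    using that x face_of_polytope_polytope[OF P] face_of_subset[OF E _ face_of_imp_subset]
    by (intro exists_coatom_face_avoiding) auto
  then obtain g where g: "\<And>F. F face_of P \<Longrightarrow> E \<subseteq> F \<Longrightarrow> x \<in> F \<Longrightarrow>
      g F face_of F \<and> E \<subseteq> g F \<and> x \<notin> g F \<and> aff_dim (g F) = aff_dim F - 1"
    by metis
  have "F \<subseteq> F'" if "F face_of P" "E \<subseteq> F" "x \<in> F" "F' face_of P" "E \<subseteq> F'" "x \<in> F'"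
      "g F = g F'" for F F'
    using face_subset_if_common_coatom[of F P F' x "g F"] g[of F] g[of F'] that face_of_imp_subset
    by metis
  then have "inj_on g {F. F face_of P \<and> E \<subseteq> F \<and> x \<in> F}"
    by (intro inj_onI subset_antisym) auto
  then show ?thesis using g face_of_trans by blast
qed

definition star_polynomial :: "'v::euclidean_space set \<Rightarrow> nat poly" where
  "star_polynomial P = rank_polynomial dim {F. F face_of P \<and> 0 \<in> F}"

definition antistar_polynomial :: "'v::euclidean_space set \<Rightarrow> nat poly" where
  "antistar_polynomial P = rank_polynomial dim {F. F face_of P \<and> 0 \<notin> F}"

lemma aff_dim_face_avoiding_zero:
  fixes P :: "'v::euclidean_space set"
  assumes "convex P" "0 \<in> P" "F face_of P" "0 \<notin> F"
  shows "aff_dim F = int (dim F) - 1"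
proof -
  have "0 \<notin> affine hull F" using face_of_imp_eq_affine_Int[OF assms(1,3)] assms by blast
  then have "aff_dim (insert 0 F) = aff_dim F + 1" by (simp add: aff_dim_insert)
  moreover have "aff_dim (insert 0 F) = int (dim F)"
    by (simp add: aff_dim_zero hull_inc dim_insert span_0)
  ultimately show ?thesis by simp
qed

lemma f_polynomial_eq_star_antistar:
  fixes P :: "'v::euclidean_space set"
  assumes P: "polytope P" "0 \<in> P"
  shows "f_polynomial P = [:0, 1:] * star_polynomial P + antistar_polynomial P"
proof -
  let ?r = "\<lambda>F :: 'v set. nat (aff_dim F + 1)"
  let ?X = "{F. F face_of P \<and> 0 \<in> F}" and ?Y = "{F. F face_of P \<and> 0 \<notin> F}"
  have "{F. F face_of P} = ?X \<union> ?Y" by blast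
  then have "f_polynomial P = rank_polynomial ?r (?X \<union> ?Y)"
    by (simp only: f_polynomial_eq_rank_polynomial[OF P(1)])
  also have "\<dots> = rank_polynomial ?r ?X + rank_polynomial ?r ?Y"
    by (intro rank_polynomial_Un_disjoint finite_faces_Collect[OF P(1)]) blast
  also have "rank_polynomial ?r ?X = rank_polynomial (\<lambda>F. Suc (dim F)) ?X"
    by (rule rank_polynomial_cong) (auto simp: aff_dim_zero hull_inc)
  also have "rank_polynomial ?r ?Y = rank_polynomial dim ?Y"
    by (rule rank_polynomial_cong)
      (auto simp: aff_dim_face_avoiding_zero[OF polytope_imp_convex[OF P(1)] P(2)])
  finally show ?thesis
    by (simp add: rank_polynomial_Suc star_polynomial_def antistar_polynomial_def)
qed

lemma star_le_antistar:
  fixes P :: "'v::euclidean_space set"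
  assumes P: "polytope P" "0 \<in> P"
  shows "coeffwise_le (star_polynomial P) (antistar_polynomial P)"
proof -
  obtain g where g: "inj_on g {F. F face_of P \<and> 0 \<in> F}" "\<And>F. F face_of P \<Longrightarrow> 0 \<in> F \<Longrightarrow>
      g F face_of P \<and> 0 \<notin> g F \<and> aff_dim (g F) = aff_dim F - 1"
    using exists_coatom_injection[OF P(1) empty_face_of, of 0] by auto
  have "dim (g F) = dim F" if F: "F face_of P" "0 \<in> F" for F
  proof -
    have "aff_dim (g F) = int (dim (g F)) - 1"
      using g(2)[OF F] P aff_dim_face_avoiding_zero polytope_imp_convex by blast
    then show ?thesis using g(2)[OF F] F(2) by (simp add: aff_dim_zero hull_inc)
  qed
  then show ?thesis
    unfolding star_polynomial_def antistar_polynomial_def using g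
    by (intro coeffwise_le_rank_polynomial_inj[where f = g] finite_faces_Collect[OF P(1)]) auto
qed

lemma exists_covering_face:
  fixes P :: "'v::euclidean_space set"
  assumes "polytope P" "E face_of P" "E \<noteq> P"
  shows "\<exists>E'. E' face_of P \<and> E \<subseteq> E' \<and> aff_dim E' = aff_dim E + 1"
  using assms
proof (induction "nat (aff_dim P - aff_dim E)" arbitrary: P rule: less_induct)
  case less
  obtain x where "x \<in> P" "x \<notin> E" using less.prems face_of_imp_subset by blast
  then obtain G where G: "G face_of P" "E \<subseteq> G" "aff_dim G = aff_dim P - 1"
    using exists_coatom_face_avoiding less.prems(1,2) by metis
  show ?case
  proof (cases "E = G")
    case True
    then show ?thesis
      using G face_of_refl[OF polytope_imp_convex[OF less.prems(1)]] face_of_imp_subset[OF G(1)]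
      by (intro exI[of _ P]) simp
  next
    case False
    have pG: "polytope G" using less.prems(1) G(1) by (rule face_of_polytope_polytope)
    have EG: "E face_of G" using face_of_subset[OF less.prems(2) G(2) face_of_imp_subset[OF G(1)]] .
    then have "aff_dim E < aff_dim G"
      using False by (intro face_of_aff_dim_lt polytope_imp_convex[OF pG])
    then obtain E' where "E' face_of G" "E \<subseteq> E'" "aff_dim E' = aff_dim E + 1"
      using less.hyps[of G] pG EG False G(3) by auto
    then show ?thesis using G(1) face_of_trans by blast
  qed
qed

definition upper_face_polynomial :: "'v::euclidean_space set \<Rightarrow> 'v set \<Rightarrow> nat poly" where
  "upper_face_polynomial E P =
     rank_polynomial (\<lambda>F. nat (aff_dim F - aff_dim E)) {F. F face_of P \<and> E \<subseteq> F}"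

lemma upper_face_polynomial_covering_face_le:
  fixes P :: "'v::euclidean_space set"
  assumes P: "polytope P" and E: "E face_of P"
    and E': "E' face_of P" "E \<subseteq> E'" "aff_dim E' = aff_dim E + 1"
  shows "coeffwise_le ([:1, 1:] * upper_face_polynomial E' P) (upper_face_polynomial E P)"
proof -
  let ?r = "\<lambda>E F :: 'v set. nat (aff_dim F - aff_dim E)"
  let ?A = "{F. F face_of P \<and> E' \<subseteq> F}" and ?B = "{F. F face_of P \<and> E \<subseteq> F \<and> \<not> E' \<subseteq> F}"
  obtain x where x: "x \<in> E'" "x \<notin> E"
    using aff_dim_subset[of E' E] E'(3) by (metis add_le_same_cancel1 not_one_le_zero subsetI)
  obtain g where g: "inj_on g {F. F face_of P \<and> E \<subseteq> F \<and> x \<in> F}"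
    "\<And>F. F face_of P \<Longrightarrow> E \<subseteq> F \<Longrightarrow> x \<in> F \<Longrightarrow>
      g F face_of P \<and> E \<subseteq> g F \<and> x \<notin> g F \<and> aff_dim (g F) = aff_dim F - 1"
    using exists_coatom_injection[OF P E x(2)] by auto
  have g_above: "g F face_of P \<and> E \<subseteq> g F \<and> x \<notin> g F \<and> aff_dim (g F) = aff_dim F - 1"
    if "F \<in> ?A" for F
    using that g(2)[of F] E'(2) x(1) by blast
  have "inj_on g ?A"
    using g(1) by (rule inj_on_subset) (use E'(2) x(1) in blast)
  moreover have "g ` ?A \<subseteq> ?B" using g_above x(1) by blast
  moreover have "?r E (g F) = ?r E' F" if "F \<in> ?A" for F
    using g_above[OF that] E'(3) by simp
  ultimately have avoiding: "coeffwise_le (rank_polynomial (?r E') ?A) (rank_polynomial (?r E) ?B)"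
    by (intro coeffwise_le_rank_polynomial_inj finite_faces_Collect[OF P])
  have "?r E F = Suc (?r E' F)" if "F \<in> ?A" for F
    using that aff_dim_subset[of E' F] E'(3) by simp
  then have "rank_polynomial (?r E) ?A = rank_polynomial (\<lambda>F. Suc (?r E' F)) ?A"
    by (rule rank_polynomial_cong)
  then have "coeffwise_le ([:0, 1:] * rank_polynomial (?r E') ?A + rank_polynomial (?r E') ?A)
      (rank_polynomial (?r E) ?A + rank_polynomial (?r E) ?B)"
    unfolding rank_polynomial_Suc using avoiding by (simp only: coeffwise_le_add coeffwise_le_refl)
  also have "\<dots> = rank_polynomial (?r E) (?A \<union> ?B)"
    by (intro rank_polynomial_Un_disjoint[symmetric] finite_faces_Collect[OF P]) blast
  also have "?A \<union> ?B = {F. F face_of P \<and> E \<subseteq> F}" using E'(2) by blast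
  finally show ?thesis by (simp add: upper_face_polynomial_def add.commute del: One_nat_def)
qed

lemma upper_face_polynomial_ge_binomial:
  fixes P :: "'v::euclidean_space set"
  assumes P: "polytope P" and "E face_of P" "aff_dim P = aff_dim E + int n"
  shows "coeffwise_le ([:1, 1:] ^ n) (upper_face_polynomial E P)"
  using assms(2,3)
proof (induction n arbitrary: E)
  case 0
  have conv: "convex P" using P by (rule polytope_imp_convex)
  have "E = P" using face_of_aff_dim_lt[OF conv 0(1)] 0(2) by fastforce
  then have "{F. F face_of P \<and> E \<subseteq> F} = {P}"
    using face_of_imp_subset face_of_refl[OF conv] by blast
  then show ?case
    by (simp add: \<open>E = P\<close> upper_face_polynomial_def rank_polynomial_def coeffwise_le_refl
        del: One_nat_def)
next
  case (Suc n)
  have "E \<noteq> P" using Suc.prems(2) by auto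
  then obtain E' where E': "E' face_of P" "E \<subseteq> E'" "aff_dim E' = aff_dim E + 1"
    using exists_covering_face[OF P Suc.prems(1)] by blast
  have "coeffwise_le ([:1, 1:] ^ n) (upper_face_polynomial E' P)"
    using Suc.prems(2) E' by (intro Suc.IH) simp_all
  then have "coeffwise_le ([:1, 1:] * [:1, 1:] ^ n) ([:1, 1:] * upper_face_polynomial E' P)"
    by (rule coeffwise_le_mult[OF coeffwise_le_refl])
  also have "coeffwise_le \<dots> (upper_face_polynomial E P)"
    by (rule upper_face_polynomial_covering_face_le[OF P Suc.prems(1) E'])
  finally show ?case by simp
qed

lemma star_polynomial_ge_binomial:
  fixes P :: "'v::euclidean_space set"
  assumes P: "polytope P" and z: "{0} face_of P"
  shows "coeffwise_le ([:1, 1:] ^ dim P) (star_polynomial P)"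
proof -
  have "0 \<in> P" using face_of_imp_subset[OF z] by simp
  then have "aff_dim P = aff_dim {0 :: 'v} + int (dim P)" by (simp add: aff_dim_zero hull_inc)
  moreover have "upper_face_polynomial {0} P = star_polynomial P"
    unfolding upper_face_polynomial_def star_polynomial_def insert_subset
    by (simp add: aff_dim_zero hull_inc rank_polynomial_def)
  ultimately show ?thesis using upper_face_polynomial_ge_binomial[OF P z] by simp
qed

section \<open>Sums of polytopes sharing a vertex\<close>

definition pointed_sum :: "'a::euclidean_space set \<Rightarrow> 'b::euclidean_space set \<Rightarrow> ('a \<times> 'b) set" where
  "pointed_sum P Q = convex hull (P \<times> {0} \<union> {0} \<times> Q)"

lemma axes_subset_pointed_sum: "P \<times> {0} \<union> {0} \<times> Q \<subseteq> pointed_sum P Q"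
  unfolding pointed_sum_def by (rule hull_subset)

lemma mem_pointed_sum_iff:
  assumes P: "convex P" "P \<noteq> {}" and Q: "convex Q" "Q \<noteq> {}"
  shows "(p, q) \<in> pointed_sum P Q \<longleftrightarrow>
    (\<exists>u. 0 \<le> u \<and> u \<le> 1 \<and> p \<in> (*\<^sub>R) u ` P \<and> q \<in> (*\<^sub>R) (1 - u) ` Q)"
proof -
  have "pointed_sum P Q = {u *\<^sub>R s + v *\<^sub>R t | u v s t.
      0 \<le> u \<and> 0 \<le> v \<and> u + v = 1 \<and> s \<in> P \<times> {0} \<and> t \<in> {0} \<times> Q}"
    unfolding pointed_sum_def
    by (rule convex_hull_union_two) (use P Q in \<open>auto intro: convex_Times\<close>)
  also have "(p, q) \<in> \<dots> \<longleftrightarrow>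
      (\<exists>u v. 0 \<le> u \<and> 0 \<le> v \<and> u + v = 1 \<and> p \<in> (*\<^sub>R) u ` P \<and> q \<in> (*\<^sub>R) v ` Q)"
    by auto
  also have "\<dots> \<longleftrightarrow> (\<exists>u. 0 \<le> u \<and> u \<le> 1 \<and> p \<in> (*\<^sub>R) u ` P \<and> q \<in> (*\<^sub>R) (1 - u) ` Q)"
    by (metis add_diff_cancel_left' diff_ge_0_iff_ge le_add_diff_inverse)
  finally show ?thesis .
qed

lemma scaleR_mem_if_convex_zero:
  assumes "convex P" "0 \<in> P" "x \<in> P" "0 \<le> u" "u \<le> 1"
  shows "u *\<^sub>R x \<in> P"
  using convexD_alt[OF assms] by simp

lemma pointed_sum_axes:
  assumes P: "convex P" "0 \<in> P" and Q: "convex Q" "0 \<in> Q"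
  shows "(x, 0) \<in> pointed_sum P Q \<longleftrightarrow> x \<in> P"
    and "(0, y) \<in> pointed_sum P Q \<longleftrightarrow> y \<in> Q"
proof -
  note mem = mem_pointed_sum_iff[OF P(1) _ Q(1)]
  have "P \<noteq> {}" "Q \<noteq> {}" using P Q by auto
  then have "(x, 0) \<in> pointed_sum P Q \<Longrightarrow> x \<in> P" "(0, y) \<in> pointed_sum P Q \<Longrightarrow> y \<in> Q"
    using scaleR_mem_if_convex_zero[OF P] scaleR_mem_if_convex_zero[OF Q] by (auto simp: mem)
  then show "(x, 0) \<in> pointed_sum P Q \<longleftrightarrow> x \<in> P" "(0, y) \<in> pointed_sum P Q \<longleftrightarrow> y \<in> Q"
    using axes_subset_pointed_sum[of P Q] by auto
qed

lemma polytope_pointed_sum: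
  assumes "polytope P" "polytope Q"
  shows "polytope (pointed_sum P Q)"
proof -
  obtain V W where VW: "finite V" "P = convex hull V" "finite W" "Q = convex hull W"
    using assms unfolding polytope_def by blast
  have "P \<times> {0::'b} = convex hull (V \<times> {0})" "{0::'a} \<times> Q = convex hull ({0} \<times> W)"
    unfolding VW by (simp_all add: convex_hull_Times)
  then have "pointed_sum P Q = convex hull (V \<times> {0} \<union> {0} \<times> W)"
    unfolding pointed_sum_def by (simp add: hull_Un_left[symmetric] hull_Un_right[symmetric])
  then show ?thesis by (simp add: polytope_convex_hull VW(1,3))
qed

lemma dim_pointed_sum: "dim (pointed_sum F G) = dim F + dim G"
proof (rule dim_between_axes_and_span_Times)
  show "pointed_sum F G \<subseteq> span F \<times> span G"
    unfolding pointed_sum_def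
    by (intro hull_minimal subspace_imp_convex subspace_Times subspace_span)
      (auto intro: span_base span_0)
qed (rule axes_subset_pointed_sum)

lemma face_of_convex_hull_eq:
  fixes U :: "'a::euclidean_space set"
  assumes "compact U" "H face_of convex hull U"
  shows "H = convex hull (H \<inter> U)"
proof
  obtain U' where U': "U' \<subseteq> U" "H = convex hull U'"
    using face_of_convex_hull_subset[OF assms] .
  then have "U' \<subseteq> H \<inter> U" by (simp add: hull_subset)
  then show "H \<subseteq> convex hull (H \<inter> U)" unfolding U'(2) by (rule hull_mono)
  show "convex hull (H \<inter> U) \<subseteq> H"
    using face_of_imp_convex[OF assms(2)] by (simp add: hull_minimal)
qed

lemma convex_hull_Int_supporting_hyperplane:
  fixes U :: "'a::euclidean_space set"
  assumes "compact U" "\<And>x. x \<in> U \<Longrightarrow> a \<bullet> x \<le> b"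
  shows "convex hull U \<inter> {x. a \<bullet> x = b} face_of convex hull U"
    and "convex hull U \<inter> {x. a \<bullet> x = b} = convex hull (U \<inter> {x. a \<bullet> x = b})"
proof -
  have "convex hull U \<subseteq> {x. a \<bullet> x \<le> b}"
    using assms(2) by (intro hull_minimal) (auto simp: convex_halfspace_le)
  then show face: "convex hull U \<inter> {x. a \<bullet> x = b} face_of convex hull U"
    by (intro face_of_Int_supporting_hyperplane_le) auto
  have "convex hull U \<inter> {x. a \<bullet> x = b} \<inter> U = U \<inter> {x. a \<bullet> x = b}"
    using hull_subset[of U convex] by blast
  then show "convex hull U \<inter> {x. a \<bullet> x = b} = convex hull (U \<inter> {x. a \<bullet> x = b})"
    using face_of_convex_hull_eq[OF assms(1) face] by simp
qed

lemma exposing_functional: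
  fixes P :: "'v::euclidean_space set"
  assumes P: "polytope P" "0 \<in> P" and F: "F face_of P"
  defines "b \<equiv> of_bool (0 \<notin> F)"
  obtains c where "\<And>x. x \<in> P \<Longrightarrow> c \<bullet> x \<le> b" "F = {x \<in> P. c \<bullet> x = b}"
proof -
  have "F exposed_face_of P"
    using P(1) F exposed_face_of_polyhedron polytope_imp_polyhedron by blast
  then obtain a b' where ab: "P \<subseteq> {x. a \<bullet> x \<le> b'}" "F = P \<inter> {x. a \<bullet> x = b'}"
    unfolding exposed_face_of_def by blast
  show ?thesis
  proof (cases "0 \<in> F")
    case True
    then have "b' = 0" using ab(2) by auto
    then show ?thesis using ab True by (intro that[of a]) (auto simp: b_def)
  next
    case False
    then have "b' > 0" using ab P(2) by (auto simp: less_le)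
    then show ?thesis using ab False by (intro that[of "a /\<^sub>R b'"]) (auto simp: b_def field_simps)
  qed
qed

lemma pointed_sum_faces:
  fixes P :: "'a::euclidean_space set" and Q :: "'b::euclidean_space set"
  assumes P: "polytope P" "0 \<in> P" and Q: "polytope Q" "0 \<in> Q"
    and F: "F face_of P" and G: "G face_of Q" and FG: "0 \<in> F \<longleftrightarrow> 0 \<in> G"
  shows "pointed_sum F G face_of pointed_sum P Q"
    and "{x. (x, 0) \<in> pointed_sum F G} = F" and "{y. (0, y) \<in> pointed_sum F G} = G"
proof -
  let ?U = "P \<times> {0 :: 'b} \<union> {0 :: 'a} \<times> Q"
  define b :: real where "b = of_bool (0 \<notin> F)"
  obtain c where c: "\<And>x. x \<in> P \<Longrightarrow> c \<bullet> x \<le> b" "F = {x \<in> P. c \<bullet> x = b}"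
    using exposing_functional[OF P F] unfolding b_def by metis
  obtain d where d: "\<And>y. y \<in> Q \<Longrightarrow> d \<bullet> y \<le> b" "G = {y \<in> Q. d \<bullet> y = b}"
    using exposing_functional[OF Q G] unfolding b_def FG by metis
  have "compact ?U"
    by (simp add: compact_Un compact_Times polytope_imp_compact P(1) Q(1))
  moreover have "(c, d) \<bullet> z \<le> b" if "z \<in> ?U" for z using that c(1) d(1) by auto
  ultimately have face: "pointed_sum P Q \<inter> {z. (c, d) \<bullet> z = b} face_of pointed_sum P Q"
    and eq: "pointed_sum P Q \<inter> {z. (c, d) \<bullet> z = b} = convex hull (?U \<inter> {z. (c, d) \<bullet> z = b})"
    unfolding pointed_sum_def by (fact convex_hull_Int_supporting_hyperplane)+
  have "?U \<inter> {z. (c, d) \<bullet> z = b} = F \<times> {0} \<union> {0} \<times> G" using c(2) d(2) by auto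
  then have "pointed_sum F G = pointed_sum P Q \<inter> {z. (c, d) \<bullet> z = b}"
    unfolding eq by (simp add: pointed_sum_def)
  moreover note axes =
    pointed_sum_axes[OF polytope_imp_convex[OF P(1)] P(2) polytope_imp_convex[OF Q(1)] Q(2)]
  ultimately show "pointed_sum F G face_of pointed_sum P Q"
    "{x. (x, 0) \<in> pointed_sum F G} = F" "{y. (0, y) \<in> pointed_sum F G} = G"
    using face c(2) d(2) by (auto simp: axes)
qed

lemma face_of_injective_linear_vimage:
  assumes "linear f" "inj f" "H face_of T"
  shows "f -` H face_of f -` T"
  unfolding face_of_def
proof (intro conjI ballI impI)
  show "convex (f -` H)"
    using assms(1) face_of_imp_convex[OF assms(3)] by (rule convex_linear_vimage)
  fix a b x assume "a \<in> f -` T" "b \<in> f -` T" "x \<in> f -` H" "x \<in> open_segment a b"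
  moreover from this have "f x \<in> open_segment (f a) (f b)"
    using assms(1,2) by (force simp: in_segment inj_def linear_add linear_scale)
  ultimately show "a \<in> f -` H" "b \<in> f -` H"
    using face_ofD[OF assms(3), of "f x" "f a" "f b"] by auto
qed (use face_of_imp_subset[OF assms(3)] in auto)

lemma face_of_pointed_sum:
  fixes P :: "'a::euclidean_space set" and Q :: "'b::euclidean_space set"
  assumes P: "polytope P" "0 \<in> P" and Q: "polytope Q" "0 \<in> Q" and H: "H face_of pointed_sum P Q"
  defines "F \<equiv> {x. (x, 0) \<in> H}" and "G \<equiv> {y. (0, y) \<in> H}"
  shows "F face_of P" and "G face_of Q" and "H = pointed_sum F G"
proof -
  let ?U = "P \<times> {0 :: 'b} \<union> {0 :: 'a} \<times> Q"
  note axes =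
    pointed_sum_axes[OF polytope_imp_convex[OF P(1)] P(2) polytope_imp_convex[OF Q(1)] Q(2)]
  have "(\<lambda>x. (x, 0)) -` H face_of (\<lambda>x. (x, 0)) -` pointed_sum P Q"
    by (rule face_of_injective_linear_vimage[OF _ _ H]) (auto intro: linearI injI)
  then show "F face_of P" by (simp add: F_def vimage_def axes)
  have "(\<lambda>y. (0, y)) -` H face_of (\<lambda>y. (0, y)) -` pointed_sum P Q"
    by (rule face_of_injective_linear_vimage[OF _ _ H]) (auto intro: linearI injI)
  then show "G face_of Q" by (simp add: G_def vimage_def axes)
  have "compact ?U"
    by (simp add: compact_Un compact_Times polytope_imp_compact P(1) Q(1))
  then have "H = convex hull (H \<inter> ?U)"
    using H unfolding pointed_sum_def by (rule face_of_convex_hull_eq)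
  moreover have "H \<inter> ?U = F \<times> {0} \<union> {0} \<times> G"
    using axes face_of_imp_subset[OF H] by (auto simp: F_def G_def)
  ultimately show "H = pointed_sum F G" by (simp add: pointed_sum_def)
qed

lemma bij_betw_pointed_sum_faces:
  assumes "polytope P" "0 \<in> P" "polytope Q" "0 \<in> Q"
  shows "bij_betw (\<lambda>(F, G). pointed_sum F G)
    {(F, G). F face_of P \<and> G face_of Q \<and> (0 \<in> F \<longleftrightarrow> 0 \<in> G)} {H. H face_of pointed_sum P Q}"
  by (rule bij_betwI[where g = "\<lambda>H. ({x. (x, 0) \<in> H}, {y. (0, y) \<in> H})"])
    (use pointed_sum_faces[OF assms] face_of_pointed_sum[OF assms] in
      \<open>auto simp: zero_prod_def[symmetric] split: prod.splits\<close>)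

lemma rank_polynomial_faces_pointed_sum:
  fixes P :: "'a::euclidean_space set" and Q :: "'b::euclidean_space set"
  assumes P: "polytope P" "0 \<in> P" and Q: "polytope Q" "0 \<in> Q"
  shows "rank_polynomial dim {H. H face_of pointed_sum P Q \<and> (0 \<in> H \<longleftrightarrow> b)} =
    rank_polynomial dim {F. F face_of P \<and> (0 \<in> F \<longleftrightarrow> b)} *
    rank_polynomial dim {G. G face_of Q \<and> (0 \<in> G \<longleftrightarrow> b)}"
    (is "_ = rank_polynomial dim ?X * rank_polynomial dim ?Y")
proof -
  let ?FG = "{(F, G). F face_of P \<and> G face_of Q \<and> (0 \<in> F \<longleftrightarrow> 0 \<in> G)}"
  let ?s = "\<lambda>(F :: 'a set, G :: 'b set). pointed_sum F G"
  have zero: "0 \<in> ?s FG \<longleftrightarrow> 0 \<in> fst FG" if "FG \<in> ?FG" for FG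
    using that pointed_sum_faces(2)[OF P Q] by (auto simp: zero_prod_def)
  have "bij_betw ?s {FG \<in> ?FG. 0 \<in> fst FG \<longleftrightarrow> b}
      {H \<in> {H. H face_of pointed_sum P Q}. 0 \<in> H \<longleftrightarrow> b}"
    by (rule bij_betw_Collect[OF bij_betw_pointed_sum_faces[OF P Q]]) (simp add: zero)
  moreover have "{FG \<in> ?FG. 0 \<in> fst FG \<longleftrightarrow> b} = ?X \<times> ?Y" by auto
  ultimately have "bij_betw ?s (?X \<times> ?Y) {H. H face_of pointed_sum P Q \<and> (0 \<in> H \<longleftrightarrow> b)}" by simp
  then have "rank_polynomial (\<lambda>(F, G). dim F + dim G) (?X \<times> ?Y) =
      rank_polynomial dim {H. H face_of pointed_sum P Q \<and> (0 \<in> H \<longleftrightarrow> b)}"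
    by (rule rank_polynomial_bij_betw) (auto simp: dim_pointed_sum)
  then show ?thesis by (simp add: rank_polynomial_Times)
qed

lemma star_polynomial_pointed_sum:
  assumes "polytope P" "0 \<in> P" "polytope Q" "0 \<in> Q"
  shows "star_polynomial (pointed_sum P Q) = star_polynomial P * star_polynomial Q"
  using rank_polynomial_faces_pointed_sum[OF assms, of True] by (simp add: star_polynomial_def)

lemma antistar_polynomial_pointed_sum:
  assumes "polytope P" "0 \<in> P" "polytope Q" "0 \<in> Q"
  shows "antistar_polynomial (pointed_sum P Q) = antistar_polynomial P * antistar_polynomial Q"
  using rank_polynomial_faces_pointed_sum[OF assms, of False] by (simp add: antistar_polynomial_def)

lemma f_polynomial_pointed_sum:
  assumes "polytope P" "0 \<in> P" "polytope Q" "0 \<in> Q"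
  shows "f_polynomial (pointed_sum P Q) =
    [:0, 1:] * (star_polynomial P * star_polynomial Q) +
    antistar_polynomial P * antistar_polynomial Q"
  using pointed_sum_axes(1)[of P Q 0] assms
  by (simp add: f_polynomial_eq_star_antistar polytope_pointed_sum polytope_imp_convex zero_prod_def
      star_polynomial_pointed_sum antistar_polynomial_pointed_sum del: mult_pCons_left)

lemma coeffwise_le_star_antistar_product:
  assumes "coeffwise_le \<alpha> a" "coeffwise_le \<alpha>' a'" "coeffwise_le \<alpha> \<beta>" "coeffwise_le a' b'"
    and "coeffwise_le (x * a + b) (x * \<alpha> + \<beta>)" "coeffwise_le (x * a' + b') (x * \<alpha>' + \<beta>')"
  shows "coeffwise_le (x * (a * a') + b * b') (x * (\<alpha> * \<alpha>') + \<beta> * \<beta>')"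
proof -
  obtain s s' t t' h h' where "a = \<alpha> + s" "a' = \<alpha>' + s'" "\<beta> = \<alpha> + t" "b' = a' + t'"
    and sums: "x * \<alpha> + \<beta> = x * a + b + h" "x * \<alpha>' + \<beta>' = x * a' + b' + h'"
    using assms by (auto simp: coeffwise_le_iff_add)
  note defs = this(1-4)
  have "x * \<alpha> + \<beta> = x * \<alpha> + (x * s + b + h)" "x * \<alpha>' + \<beta>' = x * \<alpha>' + (x * s' + b' + h')"
    using sums by (simp_all add: defs(1,2) algebra_simps)
  then have \<beta>: "\<beta> = x * s + b + h" and "\<beta>' = x * s' + b' + h'"
    by (simp_all only: add_left_cancel)
  then have "\<beta> * \<beta>' = x * s' * \<beta> + \<beta> * b' + \<beta> * h'"
    by (simp add: algebra_simps)
  also have "\<dots> = x * s' * (\<alpha> + t) + (x * s + b + h) * b' + \<beta> * h'"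
    by (simp only: \<beta>[symmetric] defs(3)[symmetric])
  finally have "x * (\<alpha> * \<alpha>') + \<beta> * \<beta>' =
      x * (a * a') + b * b' + (x * s * t' + x * s' * t + h * b' + \<beta> * h')"
    by (simp add: defs(1,2,4) algebra_simps)
  then show ?thesis unfolding coeffwise_le_iff_add by blast
qed

lemma coeffwise_le_f_polynomial_pointed_sum:
  fixes P P' :: "'a::euclidean_space set" and Q Q' :: "'b::euclidean_space set"
  assumes P: "polytope P" "0 \<in> P" and P': "polytope P'" "0 \<in> P'"
    and Q: "polytope Q" "0 \<in> Q" and Q': "polytope Q'" "0 \<in> Q'"
    and "coeffwise_le (f_polynomial P) (f_polynomial P')"
    and "coeffwise_le (f_polynomial Q) (f_polynomial Q')"
    and "coeffwise_le (star_polynomial P') (star_polynomial P)"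
    and "coeffwise_le (star_polynomial Q') (star_polynomial Q)"
  shows "coeffwise_le (f_polynomial (pointed_sum P Q)) (f_polynomial (pointed_sum P' Q'))"
  unfolding f_polynomial_pointed_sum[OF P Q] f_polynomial_pointed_sum[OF P' Q']
  using assms star_le_antistar[OF P'] star_le_antistar[OF Q]
  by (intro coeffwise_le_star_antistar_product) (simp_all only: f_polynomial_eq_star_antistar)

section \<open>Sections of cones\<close>

definition cone_section :: "'v::euclidean_space set \<Rightarrow> 'v set \<Rightarrow> 'v set" where
  "cone_section K S = {x \<in> K. \<forall>a\<in>S. a \<bullet> x \<le> 1}"

lemma mem_scaleR_cone_section_iff:
  assumes K: "cone K" "0 \<in> K" and pointed: "\<And>x. x \<in> K \<Longrightarrow> \<forall>a\<in>S. a \<bullet> x \<le> 0 \<Longrightarrow> x = 0"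
    and u: "0 \<le> u"
  shows "x \<in> (*\<^sub>R) u ` cone_section K S \<longleftrightarrow> x \<in> K \<and> (\<forall>a\<in>S. a \<bullet> x \<le> u)"
proof (cases "u = 0")
  case True
  have "0 \<in> cone_section K S" using K(2) by (simp add: cone_section_def)
  then have "(*\<^sub>R) u ` cone_section K S = {0}" using True by auto
  then show ?thesis using True K(2) pointed by auto
next
  case False
  then have "0 < u" using u by simp
  have "x \<in> (*\<^sub>R) u ` cone_section K S \<longleftrightarrow> x /\<^sub>R u \<in> cone_section K S"
    using False by (auto simp: image_iff intro!: bexI[of _ "x /\<^sub>R u"])
  moreover have "x /\<^sub>R u \<in> K \<longleftrightarrow> x \<in> K"
    using \<open>0 < u\<close> mem_cone[OF K(1), of "x /\<^sub>R u" u] mem_cone[OF K(1), of x "inverse u"] by auto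
  moreover have "a \<bullet> (x /\<^sub>R u) \<le> 1 \<longleftrightarrow> a \<bullet> x \<le> u" for a
    using \<open>0 < u\<close> by (simp add: field_simps)
  ultimately show ?thesis by (simp add: cone_section_def)
qed

lemma convex_cone_section:
  assumes "convex K"
  shows "convex (cone_section K S)"
proof -
  have "cone_section K S = K \<inter> (\<Inter>a\<in>S. {x. a \<bullet> x \<le> 1})" by (auto simp: cone_section_def)
  then show ?thesis using assms by (simp add: convex_Int convex_INT convex_halfspace_le)
qed

lemma exists_separating_element:
  fixes X Y :: "'a::linorder set"
  assumes "finite X" "X \<noteq> {}" "\<And>x y. x \<in> X \<Longrightarrow> y \<in> Y \<Longrightarrow> x \<le> y"
  shows "\<exists>u. (\<forall>x\<in>X. x \<le> u) \<and> (\<forall>y\<in>Y. u \<le> y)"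
  using assms Max_ge Max_in by blast

lemma mem_pointed_sum_cone_sections_iff:
  fixes K :: "'a::euclidean_space set" and L :: "'b::euclidean_space set"
  assumes K: "convex K" "cone K" "0 \<in> K" "\<And>x. x \<in> K \<Longrightarrow> \<forall>a\<in>S. a \<bullet> x \<le> 0 \<Longrightarrow> x = 0"
    and L: "convex L" "cone L" "0 \<in> L" "\<And>y. y \<in> L \<Longrightarrow> \<forall>b\<in>T. b \<bullet> y \<le> 0 \<Longrightarrow> y = 0"
    and S: "finite S" "0 \<in> S" and T: "0 \<in> T"
  shows "(x, y) \<in> pointed_sum (cone_section K S) (cone_section L T) \<longleftrightarrow>
    x \<in> K \<and> y \<in> L \<and> (\<forall>a\<in>S. \<forall>b\<in>T. a \<bullet> x + b \<bullet> y \<le> 1)"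
proof -
  have "(x, y) \<in> pointed_sum (cone_section K S) (cone_section L T) \<longleftrightarrow> (\<exists>u. 0 \<le> u \<and> u \<le> 1 \<and>
      x \<in> (*\<^sub>R) u ` cone_section K S \<and> y \<in> (*\<^sub>R) (1 - u) ` cone_section L T)"
    using K(1,3) L(1,3)
    by (intro mem_pointed_sum_iff convex_cone_section) (auto simp: cone_section_def)
  also have "\<dots> \<longleftrightarrow> (\<exists>u. 0 \<le> u \<and> u \<le> 1 \<and>
      (x \<in> K \<and> (\<forall>a\<in>S. a \<bullet> x \<le> u)) \<and> (y \<in> L \<and> (\<forall>b\<in>T. b \<bullet> y \<le> 1 - u)))"
    by (simp add: mem_scaleR_cone_section_iff[OF K(2-4)] mem_scaleR_cone_section_iff[OF L(2-4)]
        cong: conj_cong)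
  also have "\<dots> \<longleftrightarrow> x \<in> K \<and> y \<in> L \<and> (\<forall>a\<in>S. \<forall>b\<in>T. a \<bullet> x + b \<bullet> y \<le> 1)" (is "_ \<longleftrightarrow> ?joint")
  proof
    assume ?joint
    moreover from this have "\<exists>u. (\<forall>c\<in>(\<lambda>a. a \<bullet> x) ` S. c \<le> u) \<and> (\<forall>d\<in>(\<lambda>b. 1 - b \<bullet> y) ` T. u \<le> d)"
      using S by (intro exists_separating_element) (auto simp: algebra_simps)
    then obtain u where "\<forall>a\<in>S. a \<bullet> x \<le> u" "\<forall>b\<in>T. b \<bullet> y \<le> 1 - u" by (auto simp: algebra_simps)
    moreover from this have "0 \<le> u" "u \<le> 1" using S(2) T by force+
    ultimately show "\<exists>u. 0 \<le> u \<and> u \<le> 1 \<and>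
        (x \<in> K \<and> (\<forall>a\<in>S. a \<bullet> x \<le> u)) \<and> (y \<in> L \<and> (\<forall>b\<in>T. b \<bullet> y \<le> 1 - u))"
      by blast
  qed force
  finally show ?thesis .
qed

section \<open>Polytopes in the nonnegative orthant\<close>

definition coordinate_subspace :: "'a set \<Rightarrow> (real ^ 'a::finite) set" where
  "coordinate_subspace A = {x. \<forall>i. i \<notin> A \<longrightarrow> x $ i = 0}"

lemma dim_eq_card_coordinates:
  fixes S :: "(real ^ 'a::finite) set"
  assumes "S \<subseteq> coordinate_subspace A" and "\<And>i. i \<in> A \<Longrightarrow> axis i 1 \<in> span S"
  shows "dim S = card A"
proof -
  let ?B = "(\<lambda>i. axis i 1 :: real ^ 'a) ` A"
  have "x \<in> span ?B" if "x \<in> S" for x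
  proof -
    have "x $ i *\<^sub>R axis i 1 \<in> span ?B" for i
      using that assms(1)
      by (cases "i \<in> A") (auto simp: coordinate_subspace_def subset_iff
          intro: span_scale span_base span_zero)
    then have "(\<Sum>i\<in>UNIV. x $ i *\<^sub>R axis i 1) \<in> span ?B" by (rule span_sum)
    then show ?thesis using basis_expansion[of x] by (simp add: scalar_mult_eq_scaleR)
  qed
  then have "span S = span ?B"
    using assms(2) by (intro span_eq[THEN iffD2]) auto
  then have "dim S = dim ?B" by (rule span_eq_dim)
  also have "\<dots> = card ?B"
    by (intro dim_eq_card_independent independent_mono[OF independent_Basis])
      (auto simp: axis_in_Basis_iff)
  also have "\<dots> = card A"
    by (intro card_image) (auto simp: inj_on_def axis_eq_axis)
  finally show ?thesis .
qed

lemma zero_face_of_nonneg: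
  fixes P :: "(real ^ 'a::finite) set"
  assumes "convex P" "0 \<in> P" "\<And>x i. x \<in> P \<Longrightarrow> 0 \<le> x $ i"
  shows "{0} face_of P"
proof -
  have "(1 :: real ^ 'a) \<bullet> x = (\<Sum>i\<in>UNIV. x $ i)" for x by (simp add: inner_vec_def)
  then have "P \<inter> {x. 1 \<bullet> x = 0} face_of P"
    using assms by (intro face_of_Int_supporting_hyperplane_ge) (auto simp: sum_nonneg)
  moreover have "P \<inter> {x. 1 \<bullet> x = 0} = {0}"
    using assms(2,3) by (auto simp: inner_vec_def sum_nonneg_eq_0_iff vec_eq_iff)
  ultimately show ?thesis by simp
qed

definition antiblocking :: "(real ^ 'a::finite) set \<Rightarrow> bool" where
  "antiblocking P \<longleftrightarrow>
     (\<forall>x\<in>P. (\<forall>i. 0 \<le> x $ i) \<and> (\<forall>y. (\<forall>i. 0 \<le> y $ i \<and> y $ i \<le> x $ i) \<longrightarrow> y \<in> P))"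

lemma antiblocking_axis_mem:
  assumes "antiblocking P" "w \<in> P"
  shows "axis i (w $ i) \<in> P" and "w - axis i (w $ i) \<in> P"
proof -
  have nonneg: "0 \<le> w $ j" for j using assms by (simp add: antiblocking_def)
  have "y \<in> P" if "\<And>j. 0 \<le> y $ j \<and> y $ j \<le> w $ j" for y
    using assms that unfolding antiblocking_def by blast
  then show "axis i (w $ i) \<in> P" "w - axis i (w $ i) \<in> P"
    by (simp_all add: axis_def nonneg)
qed

definition coordinate_support :: "(real ^ 'a::finite) set \<Rightarrow> 'a set" where
  "coordinate_support F = {i. \<exists>x\<in>F. x $ i \<noteq> 0}"

lemma antiblocking_face_through_zero:
  fixes P :: "(real ^ 'a::finite) set"
  assumes P: "polytope P" "antiblocking P" and F: "F face_of P" "0 \<in> F"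
  shows "F = P \<inter> coordinate_subspace (coordinate_support F)"
proof
  show "F \<subseteq> P \<inter> coordinate_subspace (coordinate_support F)"
    using face_of_imp_subset[OF F(1)] by (auto simp: coordinate_subspace_def coordinate_support_def)
  have "0 \<in> P" using F face_of_imp_subset by blast
  then obtain c where c: "\<And>x. x \<in> P \<Longrightarrow> c \<bullet> x \<le> 0" "F = {x \<in> P. c \<bullet> x = 0}"
    using exposing_functional[OF P(1) _ F(1)] F(2) by auto
  have zero: "c $ i = 0" if i: "i \<in> coordinate_support F" for i
  proof -
    obtain w where w: "w \<in> F" "w $ i \<noteq> 0" using i by (auto simp: coordinate_support_def)
    let ?u = "axis i (w $ i)"
    have "?u \<in> P" "w - ?u \<in> P" using antiblocking_axis_mem[OF P(2)] w(1) c(2) by auto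
    then have "c \<bullet> ?u \<le> 0" "c \<bullet> (w - ?u) \<le> 0" using c(1) by auto
    moreover have "c \<bullet> w = 0" using w(1) c(2) by auto
    ultimately have "c \<bullet> ?u = 0" by (simp add: inner_diff_right)
    then show ?thesis using w(2) by (simp add: inner_axis)
  qed
  show "P \<inter> coordinate_subspace (coordinate_support F) \<subseteq> F"
  proof
    fix x assume x: "x \<in> P \<inter> coordinate_subspace (coordinate_support F)"
    then have "c $ i * x $ i = 0" for i
      using zero[of i] by (auto simp: coordinate_subspace_def)
    then have "c \<bullet> x = 0" unfolding inner_vec_def by (intro sum.neutral) simp
    then show "x \<in> F" using x c(2) by simp
  qed
qed

lemma dim_antiblocking_face_through_zero:
  fixes P :: "(real ^ 'a::finite) set"
  assumes P: "polytope P" "antiblocking P" and F: "F face_of P" "0 \<in> F"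
  shows "dim F = card (coordinate_support F)"
proof (rule dim_eq_card_coordinates)
  note F_eq = antiblocking_face_through_zero[OF assms]
  show "F \<subseteq> coordinate_subspace (coordinate_support F)" using F_eq by blast
  fix i assume i: "i \<in> coordinate_support F"
  then obtain w where w: "w \<in> F" "w $ i \<noteq> 0" by (auto simp: coordinate_support_def)
  have "axis i (w $ i) \<in> P" using antiblocking_axis_mem(1)[OF P(2)] w(1) F_eq by blast
  then have "axis i (w $ i) \<in> F"
    using i by (subst F_eq) (auto simp: coordinate_subspace_def axis_def)
  then have "(1 / w $ i) *\<^sub>R axis i (w $ i) \<in> span F" by (intro span_scale span_base)
  moreover have "(1 / w $ i) *\<^sub>R axis i (w $ i) = axis i (1 :: real)"
    using w(2) by (simp add: vec_eq_iff axis_def)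
  ultimately show "axis i 1 \<in> span F" by simp
qed

lemma star_polynomial_antiblocking_le:
  fixes P :: "(real ^ 'a::finite) set"
  assumes P: "polytope P" "antiblocking P" and A: "P \<subseteq> coordinate_subspace A"
  shows "coeffwise_le (star_polynomial P) ([:1, 1:] ^ card A)"
proof -
  let ?X = "{F. F face_of P \<and> 0 \<in> F}"
  have "inj_on coordinate_support ?X"
    by (rule inj_on_inverseI[where g = "\<lambda>B. P \<inter> coordinate_subspace B"])
      (use antiblocking_face_through_zero[OF P] in auto)
  moreover have "coordinate_support ` ?X \<subseteq> Pow A"
    using A face_of_imp_subset by (fastforce simp: coordinate_support_def coordinate_subspace_def)
  ultimately have "coeffwise_le (star_polynomial P) (rank_polynomial card (Pow A))"
    unfolding star_polynomial_def
    using dim_antiblocking_face_through_zero[OF P]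
    by (intro coeffwise_le_rank_polynomial_inj) auto
  then show ?thesis by (simp only: rank_polynomial_card_Pow finite_code)
qed

section \<open>Order polytopes and chain polytopes\<close>

lemma partial_order_on_laws:
  assumes "partial_order_on A r"
  shows "r \<subseteq> A \<times> A" "\<And>x. x \<in> A \<Longrightarrow> (x, x) \<in> r"
    "\<And>x y z. (x, y) \<in> r \<Longrightarrow> (y, z) \<in> r \<Longrightarrow> (x, z) \<in> r"
    "\<And>x y. (x, y) \<in> r \<Longrightarrow> (y, x) \<in> r \<Longrightarrow> x = y"
  using assms unfolding partial_order_on_def preorder_on_def refl_on_def trans_def antisym_def
  by blast+

lemma mem_order_polytope_iff:
  "x \<in> order_polytope A r \<longleftrightarrow> x \<in> coordinate_subspace A \<and>
    (\<forall>i\<in>A. 0 \<le> x $ i \<and> x $ i \<le> 1) \<and> (\<forall>i j. (i, j) \<in> r \<longrightarrow> x $ i \<le> x $ j)"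
  by (simp add: order_polytope_def coordinate_subspace_def)

lemma mem_chain_polytope_iff:
  "x \<in> chain_polytope A r \<longleftrightarrow> x \<in> coordinate_subspace A \<and>
    (\<forall>i\<in>A. 0 \<le> x $ i) \<and> (\<forall>K\<in>Chains r. (\<Sum>i\<in>K. x $ i) \<le> 1)"
  by (simp add: chain_polytope_def coordinate_subspace_def)

lemma zero_in_order_polytope: "0 \<in> order_polytope A r"
  by (simp add: order_polytope_def)

lemma zero_in_chain_polytope: "0 \<in> chain_polytope A r"
  by (simp add: chain_polytope_def)

lemma dim_order_polytope:
  assumes "partial_order_on A r"
  shows "dim (order_polytope A r) = card A"
proof (rule dim_eq_card_coordinates)
  note r = partial_order_on_laws[OF assms]
  fix i assume i: "i \<in> A"
  let ?x = "\<chi> j. if (i, j) \<in> r then 1 else (0 :: real)"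
  let ?y = "\<chi> j. if (i, j) \<in> r \<and> i \<noteq> j then 1 else (0 :: real)"
  have "?x \<in> order_polytope A r" "?y \<in> order_polytope A r"
    using r(1) r(3)[of i] r(4)[of _ i] by (auto simp: order_polytope_def)
  then have "?x - ?y \<in> span (order_polytope A r)" by (intro span_diff span_base)
  moreover have "?x - ?y = axis i 1" using r(2)[OF i] by (auto simp: vec_eq_iff axis_def)
  ultimately show "axis i 1 \<in> span (order_polytope A r)" by simp
qed (auto simp: mem_order_polytope_iff)

lemma star_polynomial_order_polytope_ge:
  assumes "partial_order_on A r"
  shows "coeffwise_le ([:1, 1:] ^ card A) (star_polynomial (order_polytope A r))"
proof -
  have "0 \<le> x $ i" if "x \<in> order_polytope A r" for x i
    using that by (cases "i \<in> A") (auto simp: order_polytope_def)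
  then have "{0} face_of order_polytope A r"
    using polytope_imp_convex[OF polytope_order_polytope] zero_in_order_polytope
    by (intro zero_face_of_nonneg)
  from star_polynomial_ge_binomial[OF polytope_order_polytope this] show ?thesis
    by (simp only: dim_order_polytope[OF assms])
qed

lemma antiblocking_chain_polytope: "antiblocking (chain_polytope A r)"
  unfolding antiblocking_def
proof (intro ballI conjI allI impI)
  fix x assume x: "x \<in> chain_polytope A r"
  then show "0 \<le> x $ i" for i by (cases "i \<in> A") (auto simp: chain_polytope_def)
  fix y assume y: "\<forall>i. 0 \<le> y $ i \<and> y $ i \<le> x $ i"
  have "(\<Sum>i\<in>K. y $ i) \<le> 1" if "K \<in> Chains r" for K
  proof -
    have "(\<Sum>i\<in>K. y $ i) \<le> (\<Sum>i\<in>K. x $ i)" using y by (intro sum_mono) blast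
    also have "\<dots> \<le> 1" using x that by (simp add: chain_polytope_def)
    finally show ?thesis .
  qed
  moreover have "y $ i = 0" if "i \<notin> A" for i
    using x y that by (metis (mono_tags, lifting) chain_polytope_def mem_Collect_eq order_antisym)
  ultimately show "y \<in> chain_polytope A r" using y by (simp add: chain_polytope_def)
qed

lemma star_polynomial_chain_polytope_le:
  assumes "partial_order_on A r"
  shows "coeffwise_le (star_polynomial (chain_polytope A r)) ([:1, 1:] ^ card A)"
  by (rule star_polynomial_antiblocking_le[OF polytope_chain_polytope[OF assms]
        antiblocking_chain_polytope])
    (auto simp: mem_chain_polytope_iff)

definition restrict_coords :: "'a set \<Rightarrow> real ^ 'a::finite \<Rightarrow> real ^ 'a" where
  "restrict_coords A x = (\<chi> i. if i \<in> A then x $ i else 0)"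

lemma affinely_isomorphic_split_coordinates:
  fixes P :: "(real ^ 'a::finite) set" and S :: "((real ^ 'a) \<times> (real ^ 'a)) set"
  assumes "A \<inter> B = {}" and P: "P \<subseteq> coordinate_subspace (A \<union> B)"
    and S: "S \<subseteq> coordinate_subspace A \<times> coordinate_subspace B"
    and iff: "\<And>x y. x \<in> coordinate_subspace A \<Longrightarrow> y \<in> coordinate_subspace B \<Longrightarrow>
      x + y \<in> P \<longleftrightarrow> (x, y) \<in> S"
  shows "affinely_isomorphic P S"
proof (rule affinely_isomorphicI[where f = "\<lambda>z. (restrict_coords A z, restrict_coords B z)"
      and g = "\<lambda>(x, y). x + y"])
  show "affine_map (\<lambda>z. (restrict_coords A z, restrict_coords B z))"
    unfolding affine_map_def by (rule linearI) (auto simp: vec_eq_iff restrict_coords_def)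
  show "affine_map (\<lambda>(x :: real ^ 'a, y). x + y)"
    unfolding affine_map_def by (rule linearI) (auto simp: zero_prod_def algebra_simps)
  have sub: "restrict_coords C z \<in> coordinate_subspace C" for C and z :: "real ^ 'a"
    by (simp add: restrict_coords_def coordinate_subspace_def)
  have sum: "restrict_coords A z + restrict_coords B z = z" if "z \<in> P" for z
    using that P assms(1) by (auto simp: vec_eq_iff restrict_coords_def coordinate_subspace_def)
  then show "(restrict_coords A z, restrict_coords B z) \<in> S" if "z \<in> P" for z
    using that iff[OF sub sub] by metis
  show "(case (restrict_coords A z, restrict_coords B z) of (x, y) \<Rightarrow> x + y) = z" if "z \<in> P" for z
    using sum[OF that] by simp
  fix p assume p: "p \<in> S"
  then obtain x y where xy: "p = (x, y)" "x \<in> coordinate_subspace A" "y \<in> coordinate_subspace B"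
    using S by auto
  show "(case p of (x, y) \<Rightarrow> x + y) \<in> P" using iff[OF xy(2,3)] p xy(1) by simp
  have "restrict_coords A (x + y) = x" "restrict_coords B (x + y) = y"
    using xy(2,3) assms(1) by (force simp: vec_eq_iff restrict_coords_def coordinate_subspace_def)+
  then show "(restrict_coords A (case p of (x, y) \<Rightarrow> x + y),
      restrict_coords B (case p of (x, y) \<Rightarrow> x + y)) = p" using xy(1) by simp
qed

lemma add_nth_disjoint_coordinates:
  assumes "A \<inter> B = {}" "x \<in> coordinate_subspace A" "y \<in> coordinate_subspace B"
  shows "i \<in> A \<Longrightarrow> (x + y) $ i = x $ i" and "i \<in> B \<Longrightarrow> (x + y) $ i = y $ i"
  using assms by (auto simp: coordinate_subspace_def)

lemma affinely_isomorphic_order_polytope_disjoint_union: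
  fixes A :: "'a::finite set"
  assumes r: "r \<subseteq> A \<times> A" and s: "s \<subseteq> B \<times> B" and dis: "A \<inter> B = {}"
  shows "affinely_isomorphic (order_polytope (A \<union> B) (r \<union> s))
    (order_polytope A r \<times> order_polytope B s)"
proof (rule affinely_isomorphic_split_coordinates[OF dis])
  fix x y assume xy: "x \<in> coordinate_subspace A" "y \<in> coordinate_subspace B"
  note nth = add_nth_disjoint_coordinates[OF dis xy]
  have "x + y \<in> coordinate_subspace (A \<union> B)"
    using xy by (simp add: coordinate_subspace_def)
  moreover have "(x + y) $ i \<le> (x + y) $ j \<longleftrightarrow> x $ i \<le> x $ j" if "(i, j) \<in> r" for i j
    using that r nth(1)[of i] nth(1)[of j] by auto
  moreover have "(x + y) $ i \<le> (x + y) $ j \<longleftrightarrow> y $ i \<le> y $ j" if "(i, j) \<in> s" for i j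
    using that s nth(2)[of i] nth(2)[of j] by auto
  ultimately show "x + y \<in> order_polytope (A \<union> B) (r \<union> s) \<longleftrightarrow>
      (x, y) \<in> order_polytope A r \<times> order_polytope B s"
    using xy by (auto simp: mem_order_polytope_iff ball_Un nth simp del: vector_add_component)
qed (auto simp: mem_order_polytope_iff)

lemma Chains_disjoint_union:
  assumes r: "r \<subseteq> A \<times> A" and s: "s \<subseteq> B \<times> B" and dis: "A \<inter> B = {}"
  shows "Chains (r \<union> s) = Chains r \<union> Chains s"
proof (intro equalityI subsetI)
  fix K assume K: "K \<in> Chains (r \<union> s)"
  then have related: "(x, y) \<in> r \<or> (y, x) \<in> r \<or> (x, y) \<in> s \<or> (y, x) \<in> s"
    if "x \<in> K" "y \<in> K" for x y
    using that by (auto simp: Chains_def)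
  show "K \<in> Chains r \<union> Chains s"
  proof (cases "K \<subseteq> A")
    case True
    then have "K \<in> Chains r" using related s dis unfolding Chains_def by blast
    then show ?thesis by blast
  next
    case False
    then have "K \<subseteq> B" using related r s dis by blast
    then have "K \<in> Chains s" using related r dis unfolding Chains_def by blast
    then show ?thesis by blast
  qed
qed (auto simp: Chains_def)

lemma Chains_subset: "r \<subseteq> A \<times> A \<Longrightarrow> K \<in> Chains r \<Longrightarrow> K \<subseteq> A"
  by (auto simp: Chains_def)

lemma affinely_isomorphic_chain_polytope_disjoint_union:
  fixes A :: "'a::finite set"
  assumes r: "r \<subseteq> A \<times> A" and s: "s \<subseteq> B \<times> B" and dis: "A \<inter> B = {}"
  shows "affinely_isomorphic (chain_polytope (A \<union> B) (r \<union> s))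
    (chain_polytope A r \<times> chain_polytope B s)"
proof (rule affinely_isomorphic_split_coordinates[OF dis])
  fix x y assume xy: "x \<in> coordinate_subspace A" "y \<in> coordinate_subspace B"
  note nth = add_nth_disjoint_coordinates[OF dis xy]
  have "x + y \<in> coordinate_subspace (A \<union> B)"
    using xy by (simp add: coordinate_subspace_def)
  moreover have "(\<Sum>i\<in>K. (x + y) $ i) = (\<Sum>i\<in>K. x $ i)" if "K \<in> Chains r" for K
    using Chains_subset[OF r that] by (intro sum.cong nth(1)) auto
  moreover have "(\<Sum>i\<in>K. (x + y) $ i) = (\<Sum>i\<in>K. y $ i)" if "K \<in> Chains s" for K
    using Chains_subset[OF s that] by (intro sum.cong nth(2)) auto
  ultimately show "x + y \<in> chain_polytope (A \<union> B) (r \<union> s) \<longleftrightarrow>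
      (x, y) \<in> chain_polytope A r \<times> chain_polytope B s"
    using xy by (auto simp: mem_chain_polytope_iff ball_Un nth Chains_disjoint_union[OF assms]
        simp del: vector_add_component)
qed (auto simp: mem_chain_polytope_iff)

section \<open>Ordinal sums\<close>

definition flip_coords :: "'a set \<Rightarrow> real ^ 'a::finite \<Rightarrow> real ^ 'a" where
  "flip_coords B x = (\<chi> i. if i \<in> B then 1 - x $ i else x $ i)"

lemma flip_coords_nth [simp]: "flip_coords B x $ i = (if i \<in> B then 1 - x $ i else x $ i)"
  by (simp add: flip_coords_def)

lemma affine_map_flip_coords: "affine_map (flip_coords B)"
  unfolding affine_map_def by (rule linearI) (auto simp: vec_eq_iff algebra_simps)

lemma inj_flip_coords: "inj (flip_coords B)"
  by (rule inj_on_inverseI[where g = "flip_coords B"]) (simp add: vec_eq_iff)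

lemma f_polynomial_vimage_flip_coords: "f_polynomial (flip_coords B -` P) = f_polynomial P"
  by (intro f_polynomial_affinely_isomorphic affinely_isomorphic_vimage affine_map_flip_coords
      inj_flip_coords)

lemma f_polynomial_order_polytope_converse:
  assumes "r \<subseteq> A \<times> A"
  shows "f_polynomial (order_polytope A (r\<inverse>)) = f_polynomial (order_polytope A r)"
proof -
  have "order_polytope A (r\<inverse>) = flip_coords A -` order_polytope A r"
    using assms by (auto simp: order_polytope_def)
  then show ?thesis by (simp only: f_polynomial_vimage_flip_coords)
qed

definition order_cone :: "'a::finite set \<Rightarrow> 'a rel \<Rightarrow> (real ^ 'a) set" where
  "order_cone A r =
     {x \<in> coordinate_subspace A. (\<forall>i\<in>A. 0 \<le> x $ i) \<and> (\<forall>i j. (i, j) \<in> r \<longrightarrow> x $ i \<le> x $ j)}"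

lemma order_cone_properties:
  shows "convex (order_cone A r)" and "cone (order_cone A r)" and "0 \<in> order_cone A r"
    and "x \<in> order_cone A r \<Longrightarrow> \<forall>i\<in>A. x $ i \<le> 0 \<Longrightarrow> x = 0"
proof -
  show "convex (order_cone A r)" "cone (order_cone A r)" "0 \<in> order_cone A r"
    by (auto simp: order_cone_def coordinate_subspace_def convex_def cone_def
        intro!: add_mono mult_left_mono)
  show "x = 0" if "x \<in> order_cone A r" "\<forall>i\<in>A. x $ i \<le> 0"
    using that by (auto simp: order_cone_def coordinate_subspace_def vec_eq_iff
        intro: order_antisym)
qed

lemma order_polytope_eq_cone_section:
  "order_polytope A r = cone_section (order_cone A r) (insert 0 ((\<lambda>i. axis i 1) ` A))"
  by (auto simp: mem_order_polytope_iff order_cone_def cone_section_def inner_axis')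

lemma mem_pointed_sum_order_polytopes_iff:
  fixes A B :: "'a::finite set"
  shows "(x, y) \<in> pointed_sum (order_polytope A r) (order_polytope B s) \<longleftrightarrow>
    x \<in> order_polytope A r \<and> y \<in> order_polytope B s \<and> (\<forall>i\<in>A. \<forall>j\<in>B. x $ i + y $ j \<le> 1)"
proof -
  have "(x, y) \<in> pointed_sum (order_polytope A r) (order_polytope B s) \<longleftrightarrow>
      x \<in> order_cone A r \<and> y \<in> order_cone B s \<and>
      (\<forall>a\<in>insert 0 ((\<lambda>i. axis i 1) ` A). \<forall>b\<in>insert 0 ((\<lambda>i. axis i 1) ` B). a \<bullet> x + b \<bullet> y \<le> 1)"
    unfolding order_polytope_eq_cone_section
    by (intro mem_pointed_sum_cone_sections_iff order_cone_properties) (auto simp: inner_axis')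
  then show ?thesis by (auto simp: order_polytope_eq_cone_section cone_section_def inner_axis')
qed

lemma flip_coords_mem_order_polytope_ordinal_sum_iff:
  fixes A :: "'a::finite set"
  assumes r: "r \<subseteq> A \<times> A" and s: "s \<subseteq> B \<times> B" and dis: "A \<inter> B = {}"
    and xy: "x \<in> coordinate_subspace A" "y \<in> coordinate_subspace B"
  shows "flip_coords B (x + y) \<in> order_polytope (A \<union> B) (ordinal_sum A r B s) \<longleftrightarrow>
    x \<in> order_polytope A r \<and> y \<in> order_polytope B (s\<inverse>) \<and> (\<forall>i\<in>A. \<forall>j\<in>B. x $ i + y $ j \<le> 1)"
    (is "?z \<in> _ \<longleftrightarrow> _")
proof -
  have zA: "?z $ i = x $ i" if "i \<in> A" for i
    using that dis xy by (auto simp: coordinate_subspace_def)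
  have zB: "?z $ i = 1 - y $ i" if "i \<in> B" for i
    using that dis xy by (auto simp: coordinate_subspace_def)
  have "?z \<in> coordinate_subspace (A \<union> B)"
    using xy by (auto simp: coordinate_subspace_def)
  moreover have "?z $ i \<le> ?z $ j \<longleftrightarrow> x $ i \<le> x $ j" if "(i, j) \<in> r" for i j
    using that r zA[of i] zA[of j] by auto
  moreover have "?z $ i \<le> ?z $ j \<longleftrightarrow> y $ j \<le> y $ i" if "(i, j) \<in> s" for i j
    using that s zB[of i] zB[of j] by auto
  moreover have "x $ i \<le> 1 - y $ j \<longleftrightarrow> x $ i + y $ j \<le> 1" for i j by linarith
  ultimately show ?thesis
    using xy by (auto simp: mem_order_polytope_iff ordinal_sum_def ball_Un zA zB
        simp del: flip_coords_nth)
qed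

lemma subspace_coordinate_subspace: "subspace (coordinate_subspace A)"
  by (auto simp: coordinate_subspace_def subspace_def)

lemma pointed_sum_subset_coordinate_subspaces:
  assumes "P \<subseteq> coordinate_subspace A" "Q \<subseteq> coordinate_subspace B"
  shows "pointed_sum P Q \<subseteq> coordinate_subspace A \<times> coordinate_subspace B"
  unfolding pointed_sum_def using assms
  by (intro hull_minimal convex_Times subspace_imp_convex subspace_coordinate_subspace)
    (auto simp: coordinate_subspace_def)

lemma f_polynomial_order_polytope_ordinal_sum:
  fixes A :: "'a::finite set"
  assumes r: "r \<subseteq> A \<times> A" and s: "s \<subseteq> B \<times> B" and dis: "A \<inter> B = {}"
  shows "f_polynomial (order_polytope (A \<union> B) (ordinal_sum A r B s)) =
    f_polynomial (pointed_sum (order_polytope A r) (order_polytope B (s\<inverse>)))"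
proof -
  let ?O = "order_polytope (A \<union> B) (ordinal_sum A r B s)"
  have "affinely_isomorphic (flip_coords B -` ?O)
      (pointed_sum (order_polytope A r) (order_polytope B (s\<inverse>)))"
  proof (rule affinely_isomorphic_split_coordinates[OF dis])
    show "flip_coords B -` ?O \<subseteq> coordinate_subspace (A \<union> B)"
      by (auto simp: mem_order_polytope_iff coordinate_subspace_def split: if_splits)
    show "pointed_sum (order_polytope A r) (order_polytope B (s\<inverse>))
        \<subseteq> coordinate_subspace A \<times> coordinate_subspace B"
      by (rule pointed_sum_subset_coordinate_subspaces) (auto simp: mem_order_polytope_iff)
  qed (simp add: flip_coords_mem_order_polytope_ordinal_sum_iff[OF assms]
      mem_pointed_sum_order_polytopes_iff)
  then show ?thesis
    by (metis f_polynomial_affinely_isomorphic f_polynomial_vimage_flip_coords)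
qed

lemma Chains_ordinal_sum:
  assumes r: "r \<subseteq> A \<times> A" and s: "s \<subseteq> B \<times> B" and dis: "A \<inter> B = {}"
  shows "Chains (ordinal_sum A r B s) = (\<lambda>(K, L). K \<union> L) ` (Chains r \<times> Chains s)"
proof
  show "Chains (ordinal_sum A r B s) \<subseteq> (\<lambda>(K, L). K \<union> L) ` (Chains r \<times> Chains s)"
  proof
    fix K assume K: "K \<in> Chains (ordinal_sum A r B s)"
    have "K \<subseteq> A \<union> B"
      using K r s unfolding Chains_def ordinal_sum_def by blast
    then have "K = (K \<inter> A) \<union> (K \<inter> B)" by blast
    moreover have "(K \<inter> A, K \<inter> B) \<in> Chains r \<times> Chains s"
      using K r s dis unfolding Chains_def ordinal_sum_def by blast
    ultimately show "K \<in> (\<lambda>(K, L). K \<union> L) ` (Chains r \<times> Chains s)"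
      by (metis (no_types, lifting) case_prod_conv image_eqI)
  qed
  show "(\<lambda>(K, L). K \<union> L) ` (Chains r \<times> Chains s) \<subseteq> Chains (ordinal_sum A r B s)"
  proof clarify
    fix K L assume KL: "K \<in> Chains r" "L \<in> Chains s"
    then have "K \<subseteq> A" "L \<subseteq> B" using Chains_subset r s by blast+
    then show "K \<union> L \<in> Chains (ordinal_sum A r B s)"
      using KL unfolding Chains_def ordinal_sum_def by blast
  qed
qed

definition nonneg_cone :: "'a::finite set \<Rightarrow> (real ^ 'a) set" where
  "nonneg_cone A = {x \<in> coordinate_subspace A. \<forall>i\<in>A. 0 \<le> x $ i}"

lemma nonneg_cone_properties:
  "convex (nonneg_cone A)" "cone (nonneg_cone A)" "0 \<in> nonneg_cone A"
  by (auto simp: nonneg_cone_def coordinate_subspace_def convex_def cone_def)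

lemma nonneg_cone_eq_0_if_chain_sums:
  assumes refl: "refl_on A r" and x: "x \<in> nonneg_cone A" "\<forall>K\<in>Chains r. (\<Sum>i\<in>K. x $ i) \<le> 0"
  shows "x = 0"
proof -
  have "x $ i = 0" if "i \<in> A" for i
  proof -
    have "{i} \<in> Chains r" using refl_onD[OF refl that] by (simp add: Chains_def)
    then have "(\<Sum>j\<in>{i}. x $ j) \<le> 0" using x(2) by blast
    then show ?thesis using x(1) that by (simp add: nonneg_cone_def order_antisym)
  qed
  then show ?thesis using x(1) by (auto simp: nonneg_cone_def coordinate_subspace_def vec_eq_iff)
qed

lemma chain_polytope_eq_cone_section:
  "chain_polytope A r = cone_section (nonneg_cone A) ((\<lambda>K. \<Sum>i\<in>K. axis i 1) ` Chains r)"
  by (auto simp: mem_chain_polytope_iff nonneg_cone_def cone_section_def inner_sum_left inner_axis')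

lemma mem_pointed_sum_chain_polytopes_iff:
  fixes A B :: "'a::finite set"
  assumes refl: "refl_on A r" "refl_on B s"
  shows "(x, y) \<in> pointed_sum (chain_polytope A r) (chain_polytope B s) \<longleftrightarrow>
    x \<in> nonneg_cone A \<and> y \<in> nonneg_cone B \<and>
    (\<forall>K\<in>Chains r. \<forall>L\<in>Chains s. (\<Sum>i\<in>K. x $ i) + (\<Sum>i\<in>L. y $ i) \<le> 1)"
proof -
  have zero: "0 \<in> (\<lambda>K. \<Sum>i\<in>K. axis i 1 :: real ^ 'a) ` Chains q" for q
    by (rule image_eqI[of _ _ "{}"]) (simp_all add: Chains_def)
  have "(x, y) \<in> pointed_sum (chain_polytope A r) (chain_polytope B s) \<longleftrightarrow>
      x \<in> nonneg_cone A \<and> y \<in> nonneg_cone B \<and>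
      (\<forall>a\<in>(\<lambda>K. \<Sum>i\<in>K. axis i 1) ` Chains r. \<forall>b\<in>(\<lambda>K. \<Sum>i\<in>K. axis i 1) ` Chains s.
        a \<bullet> x + b \<bullet> y \<le> 1)"
    unfolding chain_polytope_eq_cone_section
    using nonneg_cone_eq_0_if_chain_sums[OF refl(1)] nonneg_cone_eq_0_if_chain_sums[OF refl(2)]
    by (intro mem_pointed_sum_cone_sections_iff nonneg_cone_properties zero)
      (auto simp: inner_sum_left inner_axis')
  then show ?thesis by (simp add: inner_sum_left inner_axis')
qed

lemma mem_chain_polytope_ordinal_sum_iff:
  fixes A :: "'a::finite set"
  assumes r: "r \<subseteq> A \<times> A" and s: "s \<subseteq> B \<times> B" and dis: "A \<inter> B = {}"
    and xy: "x \<in> coordinate_subspace A" "y \<in> coordinate_subspace B"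
  shows "x + y \<in> chain_polytope (A \<union> B) (ordinal_sum A r B s) \<longleftrightarrow>
    x \<in> nonneg_cone A \<and> y \<in> nonneg_cone B \<and>
    (\<forall>K\<in>Chains r. \<forall>L\<in>Chains s. (\<Sum>i\<in>K. x $ i) + (\<Sum>i\<in>L. y $ i) \<le> 1)"
proof -
  note nth = add_nth_disjoint_coordinates[OF dis xy]
  have "(\<Sum>i\<in>K \<union> L. (x + y) $ i) = (\<Sum>i\<in>K. x $ i) + (\<Sum>i\<in>L. y $ i)"
    if "K \<in> Chains r" "L \<in> Chains s" for K L
  proof -
    have sub: "K \<subseteq> A" "L \<subseteq> B" using Chains_subset r s that by blast+
    then have "(\<Sum>i\<in>K \<union> L. (x + y) $ i) = (\<Sum>i\<in>K. (x + y) $ i) + (\<Sum>i\<in>L. (x + y) $ i)"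
      using dis by (intro sum.union_disjoint) auto
    also have "\<dots> = (\<Sum>i\<in>K. x $ i) + (\<Sum>i\<in>L. y $ i)"
      using sub by (intro arg_cong2[of _ _ _ _ "(+)"] sum.cong nth) auto
    finally show ?thesis .
  qed
  moreover have "x + y \<in> coordinate_subspace (A \<union> B)"
    using xy by (simp add: coordinate_subspace_def)
  ultimately show ?thesis
    using xy by (auto simp: mem_chain_polytope_iff nonneg_cone_def Chains_ordinal_sum[OF r s dis]
        ball_Un nth simp del: vector_add_component)
qed

lemma f_polynomial_chain_polytope_ordinal_sum:
  fixes A :: "'a::finite set"
  assumes po: "partial_order_on A r" "partial_order_on B s" and dis: "A \<inter> B = {}"
  shows "f_polynomial (chain_polytope (A \<union> B) (ordinal_sum A r B s)) =
    f_polynomial (pointed_sum (chain_polytope A r) (chain_polytope B s))"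
proof (intro f_polynomial_affinely_isomorphic affinely_isomorphic_split_coordinates[OF dis])
  show "pointed_sum (chain_polytope A r) (chain_polytope B s)
      \<subseteq> coordinate_subspace A \<times> coordinate_subspace B"
    by (rule pointed_sum_subset_coordinate_subspaces) (auto simp: mem_chain_polytope_iff)
  show "chain_polytope (A \<union> B) (ordinal_sum A r B s) \<subseteq> coordinate_subspace (A \<union> B)"
    by (auto simp: mem_chain_polytope_iff)
qed (simp add: mem_chain_polytope_ordinal_sum_iff[OF partial_order_on_laws(1)[OF po(1)]
      partial_order_on_laws(1)[OF po(2)] dis]
      mem_pointed_sum_chain_polytopes_iff[OF partial_order_onD(1)[OF po(1)]
        partial_order_onD(1)[OF po(2)]])

section \<open>Sums over principal ideals\<close>

text \<open>With the reflexive closure of \<open>r\<close>, the map is the identity on the coordinates outside the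
  field of \<open>r\<close> and therefore invertible on the whole space.\<close>

definition down_sum :: "'a rel \<Rightarrow> real ^ 'a::finite \<Rightarrow> real ^ 'a" where
  "down_sum r y = (\<chi> c. \<Sum>i | (i, c) \<in> r\<^sup>=. y $ i)"

lemma linear_down_sum: "linear (down_sum r)"
  by (rule linearI) (simp_all add: down_sum_def vec_eq_iff sum.distrib sum_distrib_left)

lemma down_sum_nth_eq_add_strict:
  "down_sum r y $ c = y $ c + (\<Sum>i | (i, c) \<in> r \<and> i \<noteq> c. y $ i)"
proof -
  have "{i. (i, c) \<in> r\<^sup>=} = insert c {i. (i, c) \<in> r \<and> i \<noteq> c}" by auto
  then show ?thesis by (simp add: down_sum_def)
qed

lemma down_sum_nth_refl:
  "(c, c) \<in> r \<Longrightarrow> down_sum r y $ c = (\<Sum>i | (i, c) \<in> r. y $ i)"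
  by (auto simp: down_sum_def intro!: sum.cong)

lemma inj_down_sum:
  assumes "partial_order_on A r"
  shows "inj (down_sum r)"
proof (subst linear_injective_0[OF linear_down_sum], intro allI impI)
  note r = partial_order_on_laws[OF assms]
  fix y assume y: "down_sum r y = 0"
  have "y $ c = 0" for c
  proof (induction "card {i. (i, c) \<in> r}" arbitrary: c rule: less_induct)
    case less
    have "y $ i = 0" if "(i, c) \<in> r" "i \<noteq> c" for i
    proof (rule less)
      have "{j. (j, i) \<in> r} \<subseteq> {j. (j, c) \<in> r}" using that(1) r(3) by blast
      moreover have "(c, c) \<in> r" "(c, i) \<notin> r" using that r by blast+
      ultimately show "card {j. (j, i) \<in> r} < card {j. (j, c) \<in> r}"
        by (intro psubset_card_mono) auto
    qed
    then have "(\<Sum>i | (i, c) \<in> r \<and> i \<noteq> c. y $ i) = 0" by (intro sum.neutral) auto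
    then show ?case using y down_sum_nth_eq_add_strict[of r y c] by simp
  qed
  then show "y = 0" by (simp add: vec_eq_iff)
qed

lemma finite_chain_has_greatest:
  assumes "finite K" "K \<noteq> {}" "K \<in> Chains r" "trans r"
  shows "\<exists>m\<in>K. \<forall>x\<in>K. (x, m) \<in> r"
proof -
  have "transp_on K (\<lambda>x y. (x, y) \<in> r)" using assms(4) by (auto intro: transp_onI dest: transD)
  moreover have "totalp_on K (\<lambda>x y. (x, y) \<in> r)"
    using assms(3) by (auto intro: totalp_onI simp: Chains_def)
  ultimately obtain m where "m \<in> K" "\<And>x. x \<in> K \<Longrightarrow> x \<noteq> m \<Longrightarrow> (x, m) \<in> r"
    using Finite_Set.bex_greatest_element[OF assms(1,2)] by blast
  moreover have "(m, m) \<in> r" using \<open>m \<in> K\<close> assms(3) by (auto simp: Chains_def)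
  ultimately show ?thesis by metis
qed

lemma nonneg_if_down_sum_mono:
  fixes r :: "'a::finite rel"
  assumes po: "partial_order_on A r" and chain: "{i. (i, c) \<in> r} \<in> Chains r"
    and mono: "\<And>i. (i, c) \<in> r \<Longrightarrow> down_sum r y $ i \<le> down_sum r y $ c"
    and nonneg: "0 \<le> down_sum r y $ c"
  shows "0 \<le> y $ c"
proof (cases "{i. (i, c) \<in> r \<and> i \<noteq> c} = {}")
  case True
  then have "down_sum r y $ c = y $ c"
    unfolding down_sum_nth_eq_add_strict by (simp only: sum.empty add_0_right)
  then show ?thesis using nonneg by simp
next
  case False
  note r = partial_order_on_laws[OF po]
  let ?S = "{i. (i, c) \<in> r \<and> i \<noteq> c}"
  have "?S \<in> Chains r" using chain by (auto simp: Chains_def)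
  then obtain p where p: "(p, c) \<in> r" "p \<noteq> c" "\<And>i. i \<in> ?S \<Longrightarrow> (i, p) \<in> r"
    using finite_chain_has_greatest[OF _ False] partial_order_onD(2)[OF po] by auto
  have "?S = {i. (i, p) \<in> r}"
    using p r(3,4) by blast
  moreover have "(p, p) \<in> r" using p(1) r(1,2) by blast
  ultimately have "down_sum r y $ c = y $ c + down_sum r y $ p"
    by (simp add: down_sum_nth_eq_add_strict[of r y c] down_sum_nth_refl)
  then show ?thesis using mono[OF p(1)] by simp
qed

lemma chain_sum_le_if_down_sum_le:
  fixes r :: "'a::finite rel"
  assumes "trans r" "K \<in> Chains r" "\<And>i. 0 \<le> y $ i" "0 \<le> u"
    and le: "\<And>m. m \<in> K \<Longrightarrow> down_sum r y $ m \<le> u"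
  shows "(\<Sum>i\<in>K. y $ i) \<le> u"
proof (cases "K = {}")
  case False
  then obtain m where m: "m \<in> K" "\<forall>x\<in>K. (x, m) \<in> r"
    using finite_chain_has_greatest[of K r] assms(1,2) by auto
  have "(\<Sum>i\<in>K. y $ i) \<le> down_sum r y $ m"
    unfolding down_sum_def using m(2) assms(3) by (auto intro: sum_mono2)
  then show ?thesis using le[OF m(1)] by simp
qed (simp add: \<open>0 \<le> u\<close>)

section \<open>Posets splitting into a forest and a dual forest\<close>

locale forest_splitting =
  fixes A D :: "'a::finite set" and r :: "'a rel"
  assumes partial_order: "partial_order_on A r"
    and D_subset: "D \<subseteq> A"
    and D_down_closed: "(i, c) \<in> r \<Longrightarrow> c \<in> D \<Longrightarrow> i \<in> D"
    and chain_below: "c \<in> D \<Longrightarrow> {i. (i, c) \<in> r} \<in> Chains r"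
    and chain_above: "c \<in> A - D \<Longrightarrow> {i. (c, i) \<in> r} \<in> Chains r"
begin

lemmas order_laws = partial_order_on_laws[OF partial_order]

definition forest :: "'a rel" where
  "forest = {(i, c) \<in> r. c \<in> D} \<union> {(i, c). (c, i) \<in> r \<and> c \<in> A - D}"

lemma forestE:
  assumes "(i, c) \<in> forest"
  obtains (below) "c \<in> D" "(i, c) \<in> r" | (above) "c \<in> A - D" "(c, i) \<in> r"
  using assms by (auto simp: forest_def)

lemma below_forest: "c \<in> D \<Longrightarrow> (i, c) \<in> forest \<longleftrightarrow> (i, c) \<in> r"
  by (auto simp: forest_def)

lemma above_forest: "c \<in> A - D \<Longrightarrow> (i, c) \<in> forest \<longleftrightarrow> (c, i) \<in> r"
  by (auto simp: forest_def)

lemma up_closed: "(c, i) \<in> r \<Longrightarrow> c \<in> A - D \<Longrightarrow> i \<in> A - D"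
  using D_down_closed order_laws(1) by blast

lemma partial_order_forest: "partial_order_on A forest"
proof -
  have "refl_on A forest" using order_laws(2) by (auto simp: forest_def refl_on_def)
  moreover have "trans forest"
  proof (rule transI)
    fix i j c assume ij: "(i, j) \<in> forest" and "(j, c) \<in> forest"
    from this(2) show "(i, c) \<in> forest"
    proof (cases rule: forestE)
      case below
      then show ?thesis using ij D_down_closed[of j c] order_laws(3) by (simp add: below_forest)
    next
      case above
      then show ?thesis using ij up_closed[of c j] order_laws(3) by (simp add: above_forest)
    qed
  qed
  moreover have "antisym forest"
    unfolding forest_def using order_laws(4) by (auto intro!: antisymI dest: D_down_closed)
  moreover have "forest \<subseteq> A \<times> A" using order_laws(1) by (auto simp: forest_def)
  ultimately show ?thesis by (simp add: partial_order_on_def preorder_on_def)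
qed

lemma principal_ideal_forest:
  assumes "c \<in> A"
  shows "{i. (i, c) \<in> forest} \<in> Chains r" and "{i. (i, c) \<in> forest} \<in> Chains forest"
proof -
  show chain: "{i. (i, c) \<in> forest} \<in> Chains r"
    using assms chain_below chain_above by (cases "c \<in> D") (simp_all add: below_forest above_forest)
  show "{i. (i, c) \<in> forest} \<in> Chains forest"
  proof (cases "c \<in> D")
    case True
    then show ?thesis using chain D_down_closed by (auto simp: below_forest Chains_def)
  next
    case False
    then show ?thesis using assms chain up_closed by (auto simp: above_forest Chains_def)
  qed
qed

lemma Chains_forest:
  assumes "K \<in> Chains r"
  shows "K \<inter> D \<in> Chains forest" "K - D \<in> Chains forest"
  using assms order_laws(1) by (auto simp: Chains_def forest_def)

definition transfer :: "real ^ 'a \<Rightarrow> real ^ 'a" where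
  "transfer y = flip_coords (A - D) (down_sum forest y)"

lemma transfer_nth:
  "transfer y $ c = (if c \<in> A - D then 1 - down_sum forest y $ c else down_sum forest y $ c)"
  by (simp add: transfer_def)

lemma down_sum_forest_outside: "c \<notin> A \<Longrightarrow> down_sum forest y $ c = y $ c"
  using partial_order_on_laws(1)[OF partial_order_forest]
  by (auto simp: down_sum_nth_eq_add_strict intro!: sum.neutral)

lemma down_sum_forest_add_le:
  assumes y: "y \<in> chain_polytope A r" and cd: "(c, d) \<in> r" "c \<in> D" "d \<in> A - D"
  shows "down_sum forest y $ c + down_sum forest y $ d \<le> 1"
proof -
  let ?K = "{i. (i, c) \<in> r}" and ?L = "{i. (d, i) \<in> r}"
  have "(i, j) \<in> r" if "i \<in> ?K" "j \<in> ?L" for i j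
    using that cd(1) order_laws(3) by blast
  then have "?K \<union> ?L \<in> Chains r"
    using chain_below[OF cd(2)] chain_above[OF cd(3)] unfolding Chains_def by blast
  then have "(\<Sum>i\<in>?K \<union> ?L. y $ i) \<le> 1" using y by (simp only: mem_chain_polytope_iff)
  moreover have "?K \<inter> ?L = {}" using D_down_closed cd up_closed by blast
  ultimately have "(\<Sum>i\<in>?K. y $ i) + (\<Sum>i\<in>?L. y $ i) \<le> 1" by (simp add: sum.union_disjoint)
  moreover have "(c, c) \<in> forest" "(d, d) \<in> forest"
    using cd(2,3) D_subset order_laws(2) by (auto simp: forest_def)
  ultimately show ?thesis using cd by (simp add: down_sum_nth_refl below_forest above_forest)
qed

lemma transfer_in_order_polytope:
  assumes y: "y \<in> chain_polytope A r"
  shows "transfer y \<in> order_polytope A r"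
proof -
  let ?z = "down_sum forest y"
  note forest = partial_order_on_laws[OF partial_order_forest]
  have nonneg: "0 \<le> y $ i" for i
    using y antiblocking_chain_polytope by (auto simp: antiblocking_def)
  have bounds: "0 \<le> ?z $ c" "?z $ c \<le> 1" if "c \<in> A" for c
  proof -
    have "?z $ c = (\<Sum>i | (i, c) \<in> forest. y $ i)"
      using forest(2)[OF that] by (rule down_sum_nth_refl)
    then show "0 \<le> ?z $ c" "?z $ c \<le> 1"
      using y principal_ideal_forest(1)[OF that] nonneg
      by (auto simp: mem_chain_polytope_iff sum_nonneg)
  qed
  have mono: "?z $ c \<le> ?z $ d" if "(c, d) \<in> forest" for c d
    unfolding down_sum_def using forest(3) that nonneg by (auto intro!: sum_mono2)
  have "transfer y $ c \<le> transfer y $ d" if cd: "(c, d) \<in> r" for c d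
  proof -
    have "c \<in> A" "d \<in> A" using cd order_laws(1) by auto
    then consider (down) "d \<in> D" "c \<in> D" | (up) "c \<in> A - D" "d \<in> A - D"
      | (across) "c \<in> D" "d \<in> A - D"
      using cd D_down_closed by blast
    then show ?thesis
    proof cases
      case down
      then show ?thesis using mono[of c d] cd by (simp add: transfer_nth below_forest)
    next
      case up
      then show ?thesis using mono[of d c] cd by (simp add: transfer_nth above_forest)
    next
      case across
      then show ?thesis using down_sum_forest_add_le[OF y cd] by (simp add: transfer_nth)
    qed
  qed
  moreover have "transfer y $ c = 0" if "c \<notin> A" for c
    using that y by (simp add: transfer_nth down_sum_forest_outside chain_polytope_def)
  ultimately show ?thesis using bounds by (simp add: order_polytope_def transfer_nth)
qed

lemma chain_sum_le_1:
  assumes K: "K \<in> Chains r" and nonneg: "\<And>i. 0 \<le> y $ i"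
    and bounds: "\<And>c. c \<in> A \<Longrightarrow> 0 \<le> down_sum forest y $ c"
      "\<And>c. c \<in> A \<Longrightarrow> down_sum forest y $ c \<le> 1"
    and across: "\<And>m n. (m, n) \<in> r \<Longrightarrow> m \<in> D \<Longrightarrow> n \<in> A - D \<Longrightarrow>
      down_sum forest y $ m + down_sum forest y $ n \<le> 1"
  shows "(\<Sum>i\<in>K. y $ i) \<le> 1"
proof -
  let ?z = "down_sum forest y"
  have KA: "K \<subseteq> A" using order_laws(1) K by (rule Chains_subset)
  have "?z $ m \<le> 1 - ?z $ n" if "m \<in> K \<inter> D" "n \<in> K - D" for m n
  proof -
    have "n \<in> A - D" "(m, n) \<in> r"
      using that K KA D_down_closed[of n m] by (auto simp: Chains_def)
    then show ?thesis using across[of m n] that by simp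
  qed
  then have "\<exists>u. (\<forall>a\<in>insert 0 ((\<lambda>m. ?z $ m) ` (K \<inter> D)). a \<le> u) \<and>
      (\<forall>b\<in>insert 1 ((\<lambda>n. 1 - ?z $ n) ` (K - D)). u \<le> b)"
    using KA bounds by (intro exists_separating_element) auto
  then obtain u where "\<forall>a\<in>insert 0 ((\<lambda>m. ?z $ m) ` (K \<inter> D)). a \<le> u"
      "\<forall>b\<in>insert 1 ((\<lambda>n. 1 - ?z $ n) ` (K - D)). u \<le> b"
    by blast
  then have u: "0 \<le> u" "u \<le> 1" "\<And>m. m \<in> K \<inter> D \<Longrightarrow> ?z $ m \<le> u"
      "\<And>n. n \<in> K - D \<Longrightarrow> ?z $ n \<le> 1 - u"
    by (simp_all add: algebra_simps)
  have "(\<Sum>i\<in>K. y $ i) = (\<Sum>i\<in>K \<inter> D. y $ i) + (\<Sum>i\<in>K - D. y $ i)"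
    by (simp add: sum.Int_Diff)
  also have "\<dots> \<le> u + (1 - u)"
    using u nonneg Chains_forest[OF K] partial_order_onD(2)[OF partial_order_forest]
    by (intro add_mono chain_sum_le_if_down_sum_le[of forest]) auto
  finally show ?thesis by simp
qed

lemma chain_polytope_if_transfer:
  assumes "transfer y \<in> order_polytope A r"
  shows "y \<in> chain_polytope A r"
proof -
  let ?z = "down_sum forest y"
  have transfer_le: "transfer y $ i \<le> transfer y $ j" if "(i, j) \<in> r" for i j
    using assms that by (simp add: order_polytope_def)
  have D: "transfer y $ c = ?z $ c" if "c \<in> D" for c using that by (simp add: transfer_nth)
  have U: "transfer y $ c = 1 - ?z $ c" if "c \<in> A - D" for c using that by (simp add: transfer_nth)
  have outside: "y $ c = 0" if "c \<notin> A" for c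
    using that assms by (simp add: order_polytope_def transfer_nth down_sum_forest_outside)
  have bounds: "0 \<le> ?z $ c" "?z $ c \<le> 1" if "c \<in> A" for c
    using that assms by (cases "c \<in> D"; force simp: order_polytope_def D U)+
  have mono: "?z $ i \<le> ?z $ c" if "(i, c) \<in> forest" for i c
    using that
  proof (cases rule: forestE)
    case below
    then show ?thesis using transfer_le[of i c] D_down_closed[of i c] D[of i] D[of c] by simp
  next
    case above
    then show ?thesis using transfer_le[of c i] up_closed[of c i] U[of i] U[of c] by simp
  qed
  have nonneg: "0 \<le> y $ c" for c
    using outside bounds(1)
      nonneg_if_down_sum_mono[OF partial_order_forest principal_ideal_forest(2) mono]
    by (cases "c \<in> A") auto
  moreover have "(\<Sum>i\<in>K. y $ i) \<le> 1" if "K \<in> Chains r" for K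
  proof (rule chain_sum_le_1[OF that nonneg bounds])
    show "?z $ m + ?z $ n \<le> 1" if "(m, n) \<in> r" "m \<in> D" "n \<in> A - D" for m n
      using transfer_le[OF that(1)] D[OF that(2)] U[OF that(3)] by simp
  qed
  ultimately show ?thesis using outside by (simp add: chain_polytope_def)
qed

lemma f_polynomial_order_polytope_eq_chain_polytope:
  "f_polynomial (order_polytope A r) = f_polynomial (chain_polytope A r)"
proof -
  have "chain_polytope A r = transfer -` order_polytope A r"
    using transfer_in_order_polytope chain_polytope_if_transfer by auto
  also have "\<dots> = down_sum forest -` flip_coords (A - D) -` order_polytope A r"
    by (auto simp: transfer_def)
  finally have "f_polynomial (chain_polytope A r) =
      f_polynomial (flip_coords (A - D) -` order_polytope A r)"
    using linear_down_sum[of forest] inj_down_sum[OF partial_order_forest]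
    by (simp add: f_polynomial_affinely_isomorphic affinely_isomorphic_vimage affine_map_def
        linear_0)
  then show ?thesis by (simp add: f_polynomial_vimage_flip_coords)
qed

end

section \<open>X-free posets\<close>

lemma X_order_eq:
  "X_order = Id \<union> {(Xa, Xc), (Xb, Xc), (Xc, Xd), (Xc, Xe), (Xa, Xd), (Xa, Xe), (Xb, Xd), (Xb, Xe)}"
  (is "_ = ?R")
proof
  show "X_order \<subseteq> ?R"
    unfolding X_order_def
  proof (rule subrelI)
    fix p q assume "(p, q) \<in> {(Xa, Xc), (Xb, Xc), (Xc, Xd), (Xc, Xe)}\<^sup>*"
    then show "(p, q) \<in> ?R" by (induction rule: rtrancl_induct) auto
  qed
  have "(Xa, Xc) \<in> X_order" "(Xb, Xc) \<in> X_order" "(Xc, Xd) \<in> X_order" "(Xc, Xe) \<in> X_order"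
    unfolding X_order_def by auto
  moreover have "refl X_order" "trans X_order"
    unfolding X_order_def by (rule refl_rtrancl, rule trans_rtrancl)
  ultimately show "?R \<subseteq> X_order" by (auto dest: transD reflD)
qed

lemma not_X_free_if_embedding:
  assumes "\<And>p. k p \<in> A" and emb: "\<And>p q. (k p, k q) \<in> r \<longleftrightarrow> (p, q) \<in> X_order"
  shows "\<not> X_free A r"
proof -
  have "inj k"
  proof (rule injI)
    fix p q assume "k p = k q"
    then have "(p, q) \<in> X_order" "(q, p) \<in> X_order"
      using emb[of p p] emb[of p q] emb[of q p] by (auto simp: X_order_eq)
    then show "p = q" by (auto simp: X_order_eq)
  qed
  then have "bij_betw (inv k) (range k) UNIV"
    by (simp add: bij_betw_inv_into inj_on_imp_bij_betw)
  moreover have "(x, y) \<in> r \<inter> range k \<times> range k \<longleftrightarrow> (inv k x, inv k y) \<in> X_order"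
    if "x \<in> range k" "y \<in> range k" for x y
    using that by (auto simp: emb inv_f_f[OF \<open>inj k\<close>])
  ultimately have "poset_isomorphic (range k) (r \<inter> range k \<times> range k) (UNIV :: X_elem set) X_order"
    unfolding poset_isomorphic_def by blast
  moreover have "range k \<subseteq> A" using assms(1) by blast
  ultimately show ?thesis unfolding X_free_def by blast
qed

lemma X_free_chain_below_or_above:
  assumes po: "partial_order_on A r" and free: "X_free A r"
  shows "{i. (i, c) \<in> r} \<in> Chains r \<or> {i. (c, i) \<in> r} \<in> Chains r"
proof (rule ccontr)
  assume "\<not> ?thesis"
  then obtain a b d e where ab: "(a, c) \<in> r" "(b, c) \<in> r" "(a, b) \<notin> r" "(b, a) \<notin> r"
    and de: "(c, d) \<in> r" "(c, e) \<in> r" "(d, e) \<notin> r" "(e, d) \<notin> r"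
    unfolding Chains_def by blast
  note r = partial_order_on_laws[OF po]
  have A: "a \<in> A" "b \<in> A" "c \<in> A" "d \<in> A" "e \<in> A" using r(1) ab de by auto
  define k where "k = case_X_elem a b c d e"
  have up: "(a, d) \<in> r" "(a, e) \<in> r" "(b, d) \<in> r" "(b, e) \<in> r"
    using r(3) ab de by blast+
  have c: "(c, a) \<notin> r" "(c, b) \<notin> r" "(d, c) \<notin> r" "(e, c) \<notin> r"
    using r(3) ab de by blast+
  then have down: "(d, a) \<notin> r" "(d, b) \<notin> r" "(e, a) \<notin> r" "(e, b) \<notin> r"
    using r(3) ab de by blast+
  have "(k p, k q) \<in> r \<longleftrightarrow> (p, q) \<in> X_order" for p q
    using ab de up c down A[THEN r(2)]
    by (cases p; cases q) (simp_all add: k_def X_order_eq)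
  moreover have "k p \<in> A" for p using A by (cases p) (simp_all add: k_def)
  ultimately show False using not_X_free_if_embedding free by metis
qed

lemma f_polynomial_X_free:
  fixes A :: "'a::finite set"
  assumes po: "partial_order_on A r" and "X_free A r"
  shows "f_polynomial (order_polytope A r) = f_polynomial (chain_polytope A r)"
proof -
  note r = partial_order_on_laws[OF po]
  define D where "D = {c \<in> A. {i. (i, c) \<in> r} \<in> Chains r}"
  interpret forest_splitting A D r
  proof
    show "i \<in> D" if "(i, c) \<in> r" "c \<in> D" for i c
    proof -
      have "{j. (j, i) \<in> r} \<subseteq> {j. (j, c) \<in> r}" using that(1) r(3) by blast
      then show ?thesis using that r(1) by (auto simp: D_def Chains_def)
    qed
    show "{i. (c, i) \<in> r} \<in> Chains r" if "c \<in> A - D" for c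
      using that X_free_chain_below_or_above[OF assms] by (auto simp: D_def)
  qed (auto simp: D_def po)
  show ?thesis by (rule f_polynomial_order_polytope_eq_chain_polytope)
qed

lemma coeffwise_le_f_polynomial_ordinal_sum:
  fixes A :: "'a::finite set"
  assumes po: "partial_order_on A r" "partial_order_on B s" and dis: "A \<inter> B = {}"
    and A: "coeffwise_le (f_polynomial (order_polytope A r)) (f_polynomial (chain_polytope A r))"
    and B: "coeffwise_le (f_polynomial (order_polytope B s)) (f_polynomial (chain_polytope B s))"
  shows "coeffwise_le (f_polynomial (order_polytope (A \<union> B) (ordinal_sum A r B s)))
    (f_polynomial (chain_polytope (A \<union> B) (ordinal_sum A r B s)))"
proof -
  note rs = partial_order_on_laws(1)[OF po(1)] partial_order_on_laws(1)[OF po(2)]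
  have star: "coeffwise_le (star_polynomial (chain_polytope C q))
      (star_polynomial (order_polytope C q'))"
    if "partial_order_on C q" "partial_order_on C q'" for C :: "'a set" and q q'
    using star_polynomial_chain_polytope_le[OF that(1)]
      star_polynomial_order_polytope_ge[OF that(2)]
    by (rule coeffwise_le_trans)
  have "partial_order_on B (s\<inverse>)" using po(2) by simp
  then have "coeffwise_le (f_polynomial (pointed_sum (order_polytope A r) (order_polytope B (s\<inverse>))))
      (f_polynomial (pointed_sum (chain_polytope A r) (chain_polytope B s)))"
    using A B star po rs(2)
    by (intro coeffwise_le_f_polynomial_pointed_sum)
      (simp_all only: polytope_order_polytope polytope_chain_polytope zero_in_order_polytope
        zero_in_chain_polytope f_polynomial_order_polytope_converse)
  then show ?thesis
    by (simp only: f_polynomial_order_polytope_ordinal_sum[OF rs dis]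
        f_polynomial_chain_polytope_ordinal_sum[OF po dis])
qed

lemma coeffwise_le_f_polynomial_disjoint_union:
  fixes A :: "'a::finite set"
  assumes po: "partial_order_on A r" "partial_order_on B s" and dis: "A \<inter> B = {}"
    and A: "coeffwise_le (f_polynomial (order_polytope A r)) (f_polynomial (chain_polytope A r))"
    and B: "coeffwise_le (f_polynomial (order_polytope B s)) (f_polynomial (chain_polytope B s))"
  shows "coeffwise_le (f_polynomial (order_polytope (A \<union> B) (r \<union> s)))
    (f_polynomial (chain_polytope (A \<union> B) (r \<union> s)))"
proof -
  note rs = partial_order_on_laws(1)[OF po(1)] partial_order_on_laws(1)[OF po(2)]
  have "coeffwise_le (f_polynomial (order_polytope A r \<times> order_polytope B s))
      (f_polynomial (chain_polytope A r \<times> chain_polytope B s))"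
    using A B po
    by (intro coeffwise_le_f_polynomial_Times polytope_order_polytope polytope_chain_polytope)
  moreover note isomorphic = affinely_isomorphic_order_polytope_disjoint_union[OF rs dis]
    affinely_isomorphic_chain_polytope_disjoint_union[OF rs dis]
  ultimately show ?thesis by (simp only: isomorphic[THEN f_polynomial_affinely_isomorphic])
qed

theorem theorem6p2:
  fixes A :: "'a::finite set" and r :: "'a rel"
  assumes "X_family A r"
  shows "coeffwise_le (f_polynomial (order_polytope A r)) (f_polynomial (chain_polytope A r))"
  using assms
proof (induction rule: X_family.induct)
  case (X_free A r)
  then show ?case by (simp add: f_polynomial_X_free coeffwise_le_refl)
next
  case (ordinal_sum A r B s)
  then show ?case using X_family_poset by (intro coeffwise_le_f_polynomial_ordinal_sum) blast+
next
  case (disjoint_union A r B s)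
  then show ?case using X_family_poset by (intro coeffwise_le_f_polynomial_disjoint_union) blast+
qed

end
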